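(* Let $K\in\mathcal{L}(Z,U)$ be such that $A+BK$ generates a bounded polynomially stable $C_0$-semigroup $T_{A+BK}(t)$ on $Z$, and assume that the exosystem generates admissible reference signals. Let $L\in\mathcal{L}(W,U)$. Then the state feedback regulation problem (SFRP) is solved by the control law $u(t)=Kz(t)+Lw(t)$ and $BL+P$ is conform for $T_{A+BK}(t)$, if and only if there exist $\Pi\in\mathcal{L}(W,Z)$ and $\Gamma\in\mathcal{L}(W,U)$ such that $\Pi(D(S))\subset D(A)$, $L=\Gamma-K\Pi$, and the regulator equations $$A\Pi+B\Gamma+P=\Pi S\ \text{ in } D(S),\qquad C\Pi=Q\ \text{ in } W$$ are satisfied.
   Context: Setting. $Z,U,Y,W$ are complex Banach spaces. The plant is $\dot z(t)=Az(t)+Bu(t)+\mathcal{U}_d(t)$, $y(t)=Cz(t)$, $t\ge 0$, $z(0)=z_0\in Z$, where $A$ generates a $C_0$-semigroup $T_A(t)$ on $Z$, $B\in\mathcal{L}(U,Z)$, $C\in\mathcal{L}(Z,Y)$. The exosystem is $\dot w(t)=Sw(t)$, $y_r(t)=Qw(t)$, $\mathcal{U}_d(t)=Pw(t)$, $t\in\mathbb{R}$, $w(0)=w_0\in W$, where $S$ generates an isometric $C_0$-group $T_S(t)$, $t\in\mathbb{R}$, on $W$, $P\in\mathcal{L}(W,Z)$, $Q\in\mathcal{L}(W,Y)$. Solutions are mild solutions. The tracking error is $e(t)=y(t)-y_r(t)=Cz(t)-Qw(t)$. Polynomial stability. A $C_0$-semigroup $T(t)$ on $Z$ with generator $G$ is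 polynomially stable if there are constants $\alpha,\beta,N>0$ with $\|T(t)G_\mu^{-\alpha}\|\le N t^{-\beta}$ for all $t>0$, where $G_\mu=\mu I-G$ and $\mu$ is a fixed real number with $\|T(t)\|\le Me^{(\mu-\varepsilon)t}$ for some $M,\varepsilon>0$ and all $t\ge 0$ (the notion does not depend on $\mu$). It is bounded if $\sup_{t\ge0}\|T(t)\|<\infty$. For a bounded polynomially stable semigroup, $\sigma(G)\subset\{\mathrm{Re}\,\lambda<0\}$ and there are $\alpha,N>0$ with $\|T(t)(-G)^{-\alpha}\|\le N/t$ for all $t>0$, equivalently (with a possibly different $N$) $\|T(t)G^{-1}\|\le N t^{-1/\alpha}$ for all $t>0$. SFRP. A control law $u(t)=Kz(t)+Lw(t)$, with $K\in\mathcal{L}(Z,U)$ and $L\in\mathcal{L}(W,U)$, solves the SFRP if: (i) $A+BK$ generates a bounded polynomially stable $C_0$-semigroup $T_{A+BK}(t)$ on $Z$; (ii) for the extended closed loop system $\dot z(t)=(A+BK)z(t)+(BL+P)w(t)$, $\dot w(t)=Sw(t)$, $t\ge0$, the tracking error $e(t)=Cz(t)-Qw(t)$ tends to $0$ as $t\to\infty$ for all initial conditions $z_0\in Z$, $w_0\in W$, and for all $z_0\in D(A)$, $w_0\in D(S)$ there is $m>0$ (depending on the initial conditions) with $\|e(t)\|_Y\le m\,t^{-1/\alpha}$ for all $t>0$, where $\alpha$ is the exponent above for $G=A+BK$. Conform operator. For a polynomially stable $C_0$-semigroup $T(t)$ on $Z$, an operator $\Delta\in\mathcal{L}(W,Z)$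 is conform for $T(t)$ if $w\mapsto\int_0^\infty T(t)\Delta T_S(-t)w\,dt$, $w\in D(S)$ (improper integral), defines a linear bounded operator from $D(S)$ to $Z$, where $D(S)$ is endowed with the norm induced by $W$. Admissible reference signals. $C_0^+(\mathbb{R},Y)$ is the space of bounded uniformly continuous functions $f:\mathbb{R}\to Y$ with $\lim_{t\to+\infty}f(t)=0$. The exosystem generates admissible reference signals if for every $w\in W$ and every $R\in\mathcal{L}(W,Y)$: $RT_S(\cdot)w\in C_0^+(\mathbb{R},Y)$ only if $Rw=0$. *)

theory Defs
  imports "HOL-Analysis.Analysis"
begin

(* Complex Banach spaces. The underlying real structure is the one of the library, so that the
   topology, the norm and the (Henstock-Kurzweil) integral are the library notions. *)

class complex_normed_vector = real_normed_vector +
  fixes scaleC :: "complex \<Rightarrow> 'a \<Rightarrow> 'a"  (infixr "*\<^sub>C" 75)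
  assumes scaleC_add_right: "a *\<^sub>C (x + y) = a *\<^sub>C x + a *\<^sub>C y"
    and scaleC_add_left: "(a + b) *\<^sub>C x = a *\<^sub>C x + b *\<^sub>C x"
    and scaleC_scaleC: "a *\<^sub>C (b *\<^sub>C x) = (a * b) *\<^sub>C x"
    and scaleR_scaleC: "r *\<^sub>R x = complex_of_real r *\<^sub>C x"
    and norm_scaleC: "norm (a *\<^sub>C x) = cmod a * norm x"

class complex_banach = complex_normed_vector + complete_space

subclass (in complex_banach) banach ..

instantiation complex :: complex_banach
begin

definition scaleC_complex :: "complex \<Rightarrow> complex \<Rightarrow> complex" where
  "scaleC_complex = (*)"

instance
  by standard (auto simp: scaleC_complex_def algebra_simps norm_mult scaleR_conv_of_real)

end

definition bounded_clinear :: "('a::complex_normed_vector \<Rightarrow> 'b::complex_normed_vector) \<Rightarrow> bool" where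
  "bounded_clinear f \<longleftrightarrow> bounded_linear f \<and> (\<forall>c x. f (c *\<^sub>C x) = c *\<^sub>C f x)"

(* Bounded linear operator defined on a subspace D that carries the norm of the ambient space. *)
definition bounded_clinear_on ::
  "'a::complex_normed_vector set \<Rightarrow> ('a \<Rightarrow> 'b::complex_normed_vector) \<Rightarrow> bool" where
  "bounded_clinear_on D f \<longleftrightarrow>
     (\<forall>x\<in>D. \<forall>y\<in>D. f (x + y) = f x + f y) \<and>
     (\<forall>c. \<forall>x\<in>D. f (c *\<^sub>C x) = c *\<^sub>C f x) \<and>
     (\<exists>k. \<forall>x\<in>D. norm (f x) \<le> k * norm x)"

(* A semigroup is a family indexed by the reals of which only the members with t \<ge> 0 matter. *)
definition C0_semigroup :: "(real \<Rightarrow> 'a::complex_banach \<Rightarrow> 'a) \<Rightarrow> bool" where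
  "C0_semigroup T \<longleftrightarrow>
     (\<forall>t\<ge>0. bounded_clinear (T t)) \<and>
     (\<forall>x. T 0 x = x) \<and>
     (\<forall>s\<ge>0. \<forall>t\<ge>0. \<forall>x. T (s + t) x = T s (T t x)) \<and>
     (\<forall>x. ((\<lambda>t. T t x) \<longlongrightarrow> x) (at_right 0))"

definition C0_group :: "(real \<Rightarrow> 'a::complex_banach \<Rightarrow> 'a) \<Rightarrow> bool" where
  "C0_group T \<longleftrightarrow>
     (\<forall>t. bounded_clinear (T t)) \<and>
     (\<forall>x. T 0 x = x) \<and>
     (\<forall>s t x. T (s + t) x = T s (T t x)) \<and>
     (\<forall>x. ((\<lambda>t. T t x) \<longlongrightarrow> x) (at 0))"

(* An unbounded operator is given by its domain D and a total function G that is only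
   meaningful on D. *)
definition generates_semigroup ::
  "'a::complex_banach set \<Rightarrow> ('a \<Rightarrow> 'a) \<Rightarrow> (real \<Rightarrow> 'a \<Rightarrow> 'a) \<Rightarrow> bool" where
  "generates_semigroup D G T \<longleftrightarrow>
     C0_semigroup T \<and>
     D = {x. \<exists>y. ((\<lambda>h. (T h x - x) /\<^sub>R h) \<longlongrightarrow> y) (at_right 0)} \<and>
     (\<forall>x\<in>D. ((\<lambda>h. (T h x - x) /\<^sub>R h) \<longlongrightarrow> G x) (at_right 0))"

definition generates_group ::
  "'a::complex_banach set \<Rightarrow> ('a \<Rightarrow> 'a) \<Rightarrow> (real \<Rightarrow> 'a \<Rightarrow> 'a) \<Rightarrow> bool" where
  "generates_group D G T \<longleftrightarrow>
     C0_group T \<and>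
     D = {x. \<exists>y. ((\<lambda>h. (T h x - x) /\<^sub>R h) \<longlongrightarrow> y) (at 0)} \<and>
     (\<forall>x\<in>D. ((\<lambda>h. (T h x - x) /\<^sub>R h) \<longlongrightarrow> G x) (at 0))"

definition isometric :: "(real \<Rightarrow> 'a::complex_normed_vector \<Rightarrow> 'a) \<Rightarrow> bool" where
  "isometric T \<longleftrightarrow> (\<forall>t x. norm (T t x) = norm x)"

definition bounded_semigroup :: "(real \<Rightarrow> 'a::complex_normed_vector \<Rightarrow> 'a) \<Rightarrow> bool" where
  "bounded_semigroup T \<longleftrightarrow> (\<exists>M. \<forall>t\<ge>0. \<forall>x. norm (T t x) \<le> M * norm x)"

(* The fractional power (mu I - G)^(-alpha), alpha > 0, where G is the generator of T and mu is
   larger than the growth bound of T, by the usual formula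
   (1 / Gamma(alpha)) * integral over s > 0 of s^(alpha-1) e^(-mu s) T(s) x. *)
definition neg_fractional_power ::
  "(real \<Rightarrow> 'a::complex_banach \<Rightarrow> 'a) \<Rightarrow> real \<Rightarrow> real \<Rightarrow> 'a \<Rightarrow> 'a" where
  "neg_fractional_power T \<mu> \<alpha> x =
     (1 / Gamma \<alpha>) *\<^sub>R integral {0..} (\<lambda>s. (s powr (\<alpha> - 1) * exp (- \<mu> * s)) *\<^sub>R T s x)"

(* Here and below an operator norm estimate is written out pointwise. *)
definition polynomially_stable :: "(real \<Rightarrow> 'a::complex_banach \<Rightarrow> 'a) \<Rightarrow> bool" where
  "polynomially_stable T \<longleftrightarrow>
     (\<exists>\<mu>. (\<exists>M>0. \<exists>\<epsilon>>0. \<forall>t\<ge>0. \<forall>x. norm (T t x) \<le> M * exp ((\<mu> - \<epsilon>) * t) * norm x) \<and>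
        (\<exists>\<alpha>>0. \<exists>\<beta>>0. \<exists>N>0. \<forall>t>0. \<forall>x.
           norm (T t (neg_fractional_power T \<mu> \<alpha> x)) \<le> N * t powr (- \<beta>) * norm x))"

definition bounded_inverse ::
  "'a::complex_banach set \<Rightarrow> ('a \<Rightarrow> 'a) \<Rightarrow> ('a \<Rightarrow> 'a) \<Rightarrow> bool" where
  "bounded_inverse D G R \<longleftrightarrow>
     bounded_clinear R \<and> (\<forall>x. R x \<in> D \<and> G (R x) = x) \<and> (\<forall>x\<in>D. R (G x) = x)"

(* 0 is in the resolvent set of G and norm (T(t) G^(-1)) \<le> N t^(-1/alpha). For a bounded
   semigroup this is equivalent, with the same alpha, to norm (T(t) (-G)^(-alpha)) \<le> N / t.
   Every bounded polynomially stable semigroup has such an exponent. *)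
definition decay_exponent ::
  "'a::complex_banach set \<Rightarrow> ('a \<Rightarrow> 'a) \<Rightarrow> (real \<Rightarrow> 'a \<Rightarrow> 'a) \<Rightarrow> real \<Rightarrow> bool" where
  "decay_exponent D G T \<alpha> \<longleftrightarrow>
     \<alpha> > 0 \<and>
     (\<exists>R. bounded_inverse D G R \<and>
        (\<exists>N>0. \<forall>t>0. \<forall>x. norm (T t (R x)) \<le> N * t powr (- 1 / \<alpha>) * norm x))"

(* Mild solution of z' = G z + f, z(0) = z0, where G generates T. *)
definition mild_solution ::
  "(real \<Rightarrow> 'a::complex_banach \<Rightarrow> 'a) \<Rightarrow> (real \<Rightarrow> 'a) \<Rightarrow> 'a \<Rightarrow> real \<Rightarrow> 'a" where
  "mild_solution T f z0 t = T t z0 + integral {0..t} (\<lambda>s. T (t - s) (f s))"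

(* e(t) = C z(t) - Q w(t) for z' = G z + Delta w, w' = S w, where G generates T and S generates
   TS. *)
definition tracking_error ::
  "(real \<Rightarrow> 'z::complex_banach \<Rightarrow> 'z) \<Rightarrow> (real \<Rightarrow> 'w::complex_banach \<Rightarrow> 'w) \<Rightarrow> ('w \<Rightarrow> 'z) \<Rightarrow>
   ('z \<Rightarrow> 'y::complex_banach) \<Rightarrow> ('w \<Rightarrow> 'y) \<Rightarrow> 'z \<Rightarrow> 'w \<Rightarrow> real \<Rightarrow> 'y" where
  "tracking_error T TS \<Delta> C Q z0 w0 t =
     C (mild_solution T (\<lambda>s. \<Delta> (TS s w0)) z0 t) - Q (TS t w0)"

(* The semigroup T generated by A + BK is unique for t \<ge> 0, and the domain of A + BK is DA.
   The error has to decay with rate t^(-1/alpha) for every decay exponent alpha of T, and there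
   is at least one such exponent. *)
definition solves_SFRP ::
  "'z::complex_banach set \<Rightarrow> ('z \<Rightarrow> 'z) \<Rightarrow> ('u::complex_banach \<Rightarrow> 'z) \<Rightarrow>
   ('z \<Rightarrow> 'y::complex_banach) \<Rightarrow> 'w::complex_banach set \<Rightarrow> (real \<Rightarrow> 'w \<Rightarrow> 'w) \<Rightarrow>
   ('w \<Rightarrow> 'z) \<Rightarrow> ('w \<Rightarrow> 'y) \<Rightarrow> ('z \<Rightarrow> 'u) \<Rightarrow> ('w \<Rightarrow> 'u) \<Rightarrow> bool" where
  "solves_SFRP DA A B C DS TS P Q K L \<longleftrightarrow>
     bounded_clinear K \<and> bounded_clinear L \<and>
     (\<exists>T. generates_semigroup DA (\<lambda>z. A z + B (K z)) T \<and>
        bounded_semigroup T \<and> polynomially_stable T \<and>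
        (\<forall>z0 w0. (tracking_error T TS (\<lambda>w. B (L w) + P w) C Q z0 w0 \<longlongrightarrow> 0) at_top) \<and>
        (\<exists>\<alpha>. decay_exponent DA (\<lambda>z. A z + B (K z)) T \<alpha>) \<and>
        (\<forall>\<alpha>. decay_exponent DA (\<lambda>z. A z + B (K z)) T \<alpha> \<longrightarrow>
           (\<forall>z0\<in>DA. \<forall>w0\<in>DS. \<exists>m>0. \<forall>t>0.
              norm (tracking_error T TS (\<lambda>w. B (L w) + P w) C Q z0 w0 t)
                \<le> m * t powr (- 1 / \<alpha>))))"

definition conform ::
  "(real \<Rightarrow> 'z::complex_banach \<Rightarrow> 'z) \<Rightarrow> 'w::complex_banach set \<Rightarrow> (real \<Rightarrow> 'w \<Rightarrow> 'w) \<Rightarrow>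
   ('w \<Rightarrow> 'z) \<Rightarrow> bool" where
  "conform T DS TS \<Delta> \<longleftrightarrow>
     bounded_clinear \<Delta> \<and>
     (\<exists>F. bounded_clinear_on DS F \<and>
        (\<forall>w\<in>DS. ((\<lambda>\<tau>. integral {0..\<tau>} (\<lambda>t. T t (\<Delta> (TS (- t) w)))) \<longlongrightarrow> F w) at_top))"

definition C0_plus :: "(real \<Rightarrow> 'y::complex_banach) set" where
  "C0_plus = {f. bounded (range f) \<and> uniformly_continuous_on UNIV f \<and> (f \<longlongrightarrow> 0) at_top}"

(* The type argument is the output space Y. *)
definition admissible_reference_signals ::
  "'y::complex_banach itself \<Rightarrow> (real \<Rightarrow> 'w::complex_banach \<Rightarrow> 'w) \<Rightarrow> bool" where
  "admissible_reference_signals _ TS \<longleftrightarrow>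
     (\<forall>w. \<forall>R :: 'w \<Rightarrow> 'y. bounded_clinear R \<longrightarrow> (\<lambda>t. R (TS t w)) \<in> C0_plus \<longrightarrow> R w = 0)"

end

theory Submission
  imports Defs
begin

text \<open>
Write \<open>G = A + B K\<close>, \<open>\<Delta> = B L + P\<close> and \<open>T\<close> for the closed loop semigroup. With \<open>\<Gamma> = L + K \<Psi>\<close> the
first regulator equation becomes the Sylvester equation \<open>G \<Psi> + \<Delta> = \<Psi> S\<close> on \<open>D(S)\<close>, where \<open>\<Psi>\<close>
stands for \<open>Pi_op\<close>. It says that \<open>t \<mapsto> \<Psi> T\<^sub>S(t) w\<close> is a trajectory of the forced plant: the mild
solution with initial value \<open>z0\<close> is \<open>T(t) (z0 - \<Psi> w0) + \<Psi> T\<^sub>S(t) w0\<close> (\<open>steady_state\<close>). Hence the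
tracking error is
\<open>e(t) = C T(t) (z0 - \<Psi> w0) + (C \<Psi> - Q) T\<^sub>S(t) w0\<close>,
a transient governed by the stability of \<open>T\<close> and a signal of the exosystem, which for admissible
reference signals cannot fade out unless it starts at \<open>0\<close>.

If the regulator equations hold, the second term is absent, and decay of the transient solves the
problem. The same formula, run from time \<open>-\<tau>\<close>, evaluates the integrals in the definition of
conformity (\<open>sylvester_imp_conform\<close>). Conversely, the operator that conformity provides on \<open>D(S)\<close>
extends to \<open>W\<close> and solves the Sylvester equation (\<open>conform_imp_sylvester\<close>); starting the plant at
\<open>z0 = \<Psi> w0\<close> removes the transient, so \<open>(C \<Psi> - Q) T\<^sub>S(t) w0\<close> tends to \<open>0\<close> and admissibility
forces \<open>C \<Psi> = Q\<close>.

The analytic core is that a bounded polynomially stable semigroup has an invertible generator and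
\<open>T(t) G\<^sup>-\<^sup>1\<close> decays polynomially (\<open>polynomially_stable_imp_decay_exponent\<close>), whereas the hypothesis
speaks of one fractional power of \<open>\<mu> - G\<close>. Fractional powers are weighted orbit integrals
\<open>\<integral> k(s) T(s) x ds\<close> whose composition is convolution of the weights. Multiplying the given power by a
complementary one produces decay of \<open>T(t) (\<mu> - G)\<^sup>-\<^sup>n\<close> for an integer \<open>n\<close>, and a Landau-type
interpolation inequality lowers \<open>n\<close> to \<open>1\<close>, each time halving the rate. Decay of
\<open>T(t) (\<mu> - G)\<^sup>-\<^sup>1\<close> bounds \<open>G\<close> from below, and resolvents at points tending to \<open>0\<close> then converge to
the inverse of \<open>-G\<close>.
\<close>


section \<open>Calculus of vector-valued functions on the half-line\<close>

lemma has_vector_derivative_iff_difference_quotient: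
  fixes f :: "real \<Rightarrow> 'a::real_normed_vector"
  shows "(f has_vector_derivative d) (at t within X) \<longleftrightarrow>
    ((\<lambda>s. (f s - f t) /\<^sub>R (s - t)) \<longlongrightarrow> d) (at t within X)"
proof -
  have eq: "norm ((f s - f t) - (s - t) *\<^sub>R d) / norm (s - t) = norm ((f s - f t) /\<^sub>R (s - t) - d)"
    if "s \<noteq> t" for s
  proof -
    have "(f s - f t) /\<^sub>R (s - t) - d = ((f s - f t) - (s - t) *\<^sub>R d) /\<^sub>R (s - t)"
      using that by (simp add: scaleR_diff_right)
    then show ?thesis
      by (simp add: divide_inverse mult.commute abs_inverse)
  qed
  have "(f has_vector_derivative d) (at t within X) \<longleftrightarrow>
    ((\<lambda>s. norm ((f s - f t) - (s - t) *\<^sub>R d) / norm (s - t)) \<longlongrightarrow> 0) (at t within X)"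
    by (simp add: has_vector_derivative_def has_derivative_iff_norm bounded_linear_scaleR_left)
  also have "\<dots> \<longleftrightarrow> ((\<lambda>s. norm ((f s - f t) /\<^sub>R (s - t) - d)) \<longlongrightarrow> 0) (at t within X)"
    by (rule filterlim_cong[OF refl refl]) (use eq in \<open>auto simp: eventually_at_filter\<close>)
  also have "\<dots> \<longleftrightarrow> ((\<lambda>s. (f s - f t) /\<^sub>R (s - t)) \<longlongrightarrow> d) (at t within X)"
    by (simp add: tendsto_norm_zero_iff LIM_zero_iff)
  finally show ?thesis .
qed

text \<open>Product rule for a strongly continuous operator family acting on a differentiable curve.
  The family need not be differentiable in operator norm: only the orbit of the frozen vector
  is differentiated, and the uniform bound absorbs the rest.\<close>

lemma has_vector_derivative_operator_family:
  fixes U :: "real \<Rightarrow> 'a::real_normed_vector \<Rightarrow> 'b::real_normed_vector"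
  assumes lin: "\<And>r. r \<in> X \<Longrightarrow> linear (U r)"
    and bd: "\<And>r x. r \<in> X \<Longrightarrow> norm (U r x) \<le> M * norm x"
    and s: "s \<in> X"
    and cont: "continuous_on X (\<lambda>r. U r f')"
    and U': "((\<lambda>r. U r (f s)) has_vector_derivative d) (at s within X)"
    and f': "(f has_vector_derivative f') (at s within X)"
  shows "((\<lambda>r. U r (f r)) has_vector_derivative (d + U s f')) (at s within X)"
proof -
  let ?q = "\<lambda>r. (f r - f s) /\<^sub>R (r - s)"
  have q: "(?q \<longlongrightarrow> f') (at s within X)"
    using f' by (simp add: has_vector_derivative_iff_difference_quotient)
  have 1: "((\<lambda>r. U r (?q r - f')) \<longlongrightarrow> 0) (at s within X)"
  proof (rule Lim_null_comparison)
    show "\<forall>\<^sub>F r in at s within X. norm (U r (?q r - f')) \<le> M * norm (?q r - f')"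
      using bd by (auto simp: eventually_at_filter)
    show "((\<lambda>r. M * norm (?q r - f')) \<longlongrightarrow> 0) (at s within X)"
      using q by (intro tendsto_mult_right_zero) (simp add: tendsto_norm_zero_iff LIM_zero_iff)
  qed
  have 2: "((\<lambda>r. U r f') \<longlongrightarrow> U s f') (at s within X)"
    using cont s by (simp add: continuous_on_def)
  have 3: "((\<lambda>r. (U r (f s) - U s (f s)) /\<^sub>R (r - s)) \<longlongrightarrow> d) (at s within X)"
    using U' by (simp add: has_vector_derivative_iff_difference_quotient)
  have "((\<lambda>r. (U r (f s) - U s (f s)) /\<^sub>R (r - s) + (U r (?q r - f') + U r f')) \<longlongrightarrow> d + (0 + U s f'))
      (at s within X)"
    by (intro tendsto_intros 1 2 3)
  moreover have "\<forall>\<^sub>F r in at s within X.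
      (U r (f s) - U s (f s)) /\<^sub>R (r - s) + (U r (?q r - f') + U r f') =
      (U r (f r) - U s (f s)) /\<^sub>R (r - s)"
    unfolding eventually_at_filter
  proof (intro always_eventually allI impI)
    fix r assume "r \<noteq> s" "r \<in> X"
    then show "(U r (f s) - U s (f s)) /\<^sub>R (r - s) + (U r (?q r - f') + U r f') =
      (U r (f r) - U s (f s)) /\<^sub>R (r - s)"
      using lin[of r] by (simp add: linear_diff linear_scale scaleR_diff_right)
  qed
  ultimately show ?thesis
    by (simp add: has_vector_derivative_iff_difference_quotient filterlim_cong)
qed

lemma has_integral_halfline:
  fixes f :: "real \<Rightarrow> 'a::banach"
  assumes int: "\<And>b. b \<ge> 0 \<Longrightarrow> f integrable_on {0..b}"
    and lim: "((\<lambda>b. integral {0..b} f) \<longlongrightarrow> l) at_top"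
  shows "(f has_integral l) {0..}"
proof -
  have Icc: "{0..} \<inter> cbox a b = {max 0 a..b}" for a b :: real
    by auto
  have sub: "f integrable_on {max 0 a..b}" for a b
  proof (cases "b \<ge> 0")
    case True
    then show ?thesis
      using integrable_on_subinterval[OF int[OF True]] by auto
  qed (simp add: integrable_on_empty)
  show ?thesis
    unfolding has_integral_alt' integrable_restrict_Int integral_restrict_Int Icc
  proof (intro conjI allI impI sub)
    fix e :: real assume "e > 0"
    then obtain b0 where b0: "\<And>b. b \<ge> b0 \<Longrightarrow> dist (integral {0..b} f) l < e"
      using lim unfolding tendsto_iff eventually_at_top_linorder by blast
    show "\<exists>B>0. \<forall>a b. ball 0 B \<subseteq> cbox a b \<longrightarrow> norm (integral {max 0 a..b} f - l) < e"
    proof (intro exI[of _ "max 1 (b0 + 1)"] conjI allI impI)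
      fix a b :: real
      assume sub: "ball 0 (max 1 (b0 + 1)) \<subseteq> cbox a b"
      have "0 \<in> ball (0::real) (max 1 (b0 + 1))" "max 0 b0 \<in> ball (0::real) (max 1 (b0 + 1))"
        by (auto simp: dist_real_def)
      then have "0 \<in> cbox a b" "max 0 b0 \<in> cbox a b"
        using sub by blast+
      then have "a \<le> 0" "b0 \<le> b"
        by auto
      then show "norm (integral {max 0 a..b} f - l) < e"
        using b0[of b] by (simp add: dist_norm)
    qed auto
  qed
qed

text \<open>On the half-line, integrability of a vector-valued continuous function comes from an
  exponential bound, which also controls the tail.\<close>

lemma exp_bounded_integral_segment:
  fixes f :: "real \<Rightarrow> 'a::banach"
  assumes cont: "continuous_on {0..} f" and nu: "\<nu> > 0"
    and bd: "\<And>s. s \<ge> 0 \<Longrightarrow> norm (f s) \<le> K * exp (- \<nu> * s)" and ab: "0 \<le> a" "a \<le> b"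
  shows "norm (integral {a..b} f) \<le> K / \<nu> * exp (- \<nu> * a)"
proof -
  have K: "K \<ge> 0"
    using bd[of 0] norm_ge_zero[of "f 0"] by (simp del: norm_ge_zero)
  have "((\<lambda>s. K * exp (- \<nu> * s)) has_integral
      (- K / \<nu> * exp (- \<nu> * b)) - (- K / \<nu> * exp (- \<nu> * a))) {a..b}"
    using nu ab
    by (intro fundamental_theorem_of_calculus)
       (auto intro!: derivative_eq_intros simp flip: has_real_derivative_iff_has_vector_derivative)
  moreover have "f integrable_on {a..b}"
    using ab by (intro integrable_continuous_interval continuous_on_subset[OF cont]) auto
  ultimately have "norm (integral {a..b} f) \<le>
      (- K / \<nu> * exp (- \<nu> * b)) - (- K / \<nu> * exp (- \<nu> * a))"
    using ab bd integral_norm_bound_integral[of f "{a..b}" "\<lambda>s. K * exp (- \<nu> * s)"]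
    by (auto simp: has_integral_iff)
  also have "\<dots> \<le> K / \<nu> * exp (- \<nu> * a)"
    using K nu by simp
  finally show ?thesis .
qed

lemma exp_bounded_integral_halfline:
  fixes f :: "real \<Rightarrow> 'a::banach"
  assumes cont: "continuous_on {0..} f" and nu: "\<nu> > 0"
    and bd: "\<And>s. s \<ge> 0 \<Longrightarrow> norm (f s) \<le> K * exp (- \<nu> * s)"
  shows "f integrable_on {0..}"
    and "((\<lambda>b. integral {0..b} f) \<longlongrightarrow> integral {0..} f) at_top"
    and "\<And>b. b \<ge> 0 \<Longrightarrow> norm (integral {0..} f - integral {0..b} f) \<le> K / \<nu> * exp (- \<nu> * b)"
    and "norm (integral {0..} f) \<le> K / \<nu>"
proof -
  have int: "f integrable_on {a..b}" if "0 \<le> a" for a b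
    using that by (intro integrable_continuous_interval continuous_on_subset[OF cont]) auto
  have diff: "norm (integral {0..c} f - integral {0..b} f) \<le> K / \<nu> * exp (- \<nu> * b)"
    if "0 \<le> b" "b \<le> c" for b c
  proof -
    have "integral {0..c} f - integral {0..b} f = integral {b..c} f"
      using Henstock_Kurzweil_Integration.integral_combine[OF that int[of 0 c]]
      by (simp add: algebra_simps)
    then show ?thesis
      using exp_bounded_integral_segment[OF cont nu bd that] by simp
  qed
  have exp0: "((\<lambda>b. K / \<nu> * exp (- \<nu> * b)) \<longlongrightarrow> 0) at_top"
    using nu
    by (intro tendsto_mult_right_zero filterlim_compose[OF exp_at_bot]
          filterlim_tendsto_neg_mult_at_bot[OF tendsto_const] filterlim_ident) auto
  have "\<exists>l. ((\<lambda>b. integral {0..b} f) \<longlongrightarrow> l) at_top"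
  proof -
    have "Cauchy (\<lambda>n. integral {0..real n} f)"
    proof (rule metric_CauchyI)
      fix e :: real assume "e > 0"
      then obtain b0 where b0: "\<And>b. b \<ge> b0 \<Longrightarrow> K / \<nu> * exp (- \<nu> * b) < e / 2"
        using order_tendstoD(2)[OF exp0, of "e/2"] unfolding eventually_at_top_linorder by auto
      obtain N :: nat where N: "real N \<ge> b0"
        using real_arch_simple by blast
      have near: "dist (integral {0..real n} f) (integral {0..real N} f) < e / 2" if "n \<ge> N" for n
        unfolding dist_norm by (rule le_less_trans[OF diff b0[OF N]]) (use that in auto)
      show "\<exists>N. \<forall>m\<ge>N. \<forall>n\<ge>N. dist (integral {0..real m} f) (integral {0..real n} f) < e"
        using near by (intro exI[of _ N] allI impI) (rule dist_triangle_half_l)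
    qed
    then obtain l where l: "(\<lambda>n. integral {0..real n} f) \<longlonglongrightarrow> l"
      using convergent_eq_Cauchy by blast
    have "norm (integral {0..b} f - l) \<le> K / \<nu> * exp (- \<nu> * b)" if "b \<ge> 0" for b
    proof (rule tendsto_upperbound[OF tendsto_norm[OF tendsto_diff[OF tendsto_const l]]])
      obtain N :: nat where N: "real N \<ge> b"
        using real_arch_simple by blast
      show "\<forall>\<^sub>F n in sequentially. norm (integral {0..b} f - integral {0..real n} f)
          \<le> K / \<nu> * exp (- \<nu> * b)"
        using diff[OF that] N
        by (subst norm_minus_commute) (auto intro!: eventually_sequentiallyI[of N])
    qed auto
    then have "((\<lambda>b. integral {0..b} f - l) \<longlongrightarrow> 0) at_top"
      by (rule Lim_null_comparison[OF eventually_at_top_linorderI[of 0] exp0])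
    then show ?thesis
      using LIM_zero_cancel[of "\<lambda>b. integral {0..b} f" l] by (intro exI)
  qed
  then obtain l where l: "((\<lambda>b. integral {0..b} f) \<longlongrightarrow> l) at_top"
    by blast
  then have hi: "(f has_integral l) {0..}"
    using int by (intro has_integral_halfline) auto
  then show "f integrable_on {0..}" and lim: "((\<lambda>b. integral {0..b} f) \<longlongrightarrow> integral {0..} f) at_top"
    using l by (auto simp: has_integral_iff)
  show tail: "norm (integral {0..} f - integral {0..b} f) \<le> K / \<nu> * exp (- \<nu> * b)"
    if "b \<ge> 0" for b
    using diff[OF that]
    by (intro tendsto_upperbound[OF tendsto_norm[OF tendsto_diff[OF lim tendsto_const]]]
          eventually_at_top_linorderI[of b]) auto
  show "norm (integral {0..} f) \<le> K / \<nu>"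
    using tail[of 0] by simp
qed

section \<open>Bounded strongly continuous semigroups\<close>

lemma bounded_clinearD: "bounded_clinear f \<Longrightarrow> bounded_linear f"
  by (simp add: bounded_clinear_def)

lemma bounded_clinear_scaleC: "bounded_clinear f \<Longrightarrow> f (c *\<^sub>C x) = c *\<^sub>C f x"
  by (simp add: bounded_clinear_def)

lemma bounded_linear_scaleC: "bounded_linear (\<lambda>x. c *\<^sub>C (x::'a::complex_normed_vector))"
proof (rule bounded_linear_intro[where K = "cmod c"])
  show "c *\<^sub>C (r *\<^sub>R x) = r *\<^sub>R (c *\<^sub>C x)" for r and x :: 'a
    by (simp add: scaleR_scaleC scaleC_scaleC mult.commute)
qed (auto simp: scaleC_add_right norm_scaleC)

locale bounded_C0_semigroup =
  fixes T :: "real \<Rightarrow> 'a::complex_banach \<Rightarrow> 'a" and D :: "'a set" and G :: "'a \<Rightarrow> 'a" and M :: real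
  assumes generates: "generates_semigroup D G T"
    and bound: "t \<ge> 0 \<Longrightarrow> norm (T t x) \<le> M * norm x"
    and M_ge_1: "M \<ge> 1"
begin

lemma bclin: "t \<ge> 0 \<Longrightarrow> bounded_clinear (T t)"
  and T_0 [simp]: "T 0 x = x"
  and T_add: "s \<ge> 0 \<Longrightarrow> t \<ge> 0 \<Longrightarrow> T (s + t) x = T s (T t x)"
  and T_at_0: "((\<lambda>t. T t x) \<longlongrightarrow> x) (at_right 0)"
  using generates by (auto simp: generates_semigroup_def C0_semigroup_def)

lemma blin: "t \<ge> 0 \<Longrightarrow> bounded_linear (T t)"
  using bclin by (rule bounded_clinearD)

lemma T_plus: "t \<ge> 0 \<Longrightarrow> T t (x + y) = T t x + T t y"
  and T_diff: "t \<ge> 0 \<Longrightarrow> T t (x - y) = T t x - T t y"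
  and T_scaleR: "t \<ge> 0 \<Longrightarrow> T t (r *\<^sub>R x) = r *\<^sub>R T t x"
  and T_zero: "t \<ge> 0 \<Longrightarrow> T t 0 = 0"
  using blin[of t] by (simp_all add: linear_add linear_diff linear_scale linear_0 bounded_linear.linear)

lemma T_commute: "s \<ge> 0 \<Longrightarrow> t \<ge> 0 \<Longrightarrow> T s (T t x) = T t (T s x)"
  by (metis T_add add.commute)

lemma generatorI: "((\<lambda>h. (T h x - x) /\<^sub>R h) \<longlongrightarrow> y) (at_right 0) \<Longrightarrow> x \<in> D \<and> G x = y"
  using generates unfolding generates_semigroup_def
  by (metis (mono_tags, lifting) mem_Collect_eq tendsto_unique trivial_limit_at_right_real)

lemma generator_limit: "x \<in> D \<Longrightarrow> ((\<lambda>h. (T h x - x) /\<^sub>R h) \<longlongrightarrow> G x) (at_right 0)"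
  using generates unfolding generates_semigroup_def by blast

lemma D_add: "x \<in> D \<Longrightarrow> y \<in> D \<Longrightarrow> x + y \<in> D \<and> G (x + y) = G x + G y"
proof (rule generatorI)
  assume "x \<in> D" "y \<in> D"
  then have "((\<lambda>h. (T h x - x) /\<^sub>R h + (T h y - y) /\<^sub>R h) \<longlongrightarrow> G x + G y) (at_right 0)"
    by (intro tendsto_add generator_limit)
  moreover have "\<forall>\<^sub>F h in at_right 0. (T h x - x) /\<^sub>R h + (T h y - y) /\<^sub>R h = (T h (x + y) - (x + y)) /\<^sub>R h"
    by (auto simp: eventually_at_filter T_plus algebra_simps)
  ultimately show "((\<lambda>h. (T h (x + y) - (x + y)) /\<^sub>R h) \<longlongrightarrow> G x + G y) (at_right 0)"
    by (rule Lim_transform_eventually)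
qed

lemma D_scaleC: "x \<in> D \<Longrightarrow> c *\<^sub>C x \<in> D \<and> G (c *\<^sub>C x) = c *\<^sub>C G x"
proof (rule generatorI)
  assume "x \<in> D"
  then have "((\<lambda>h. c *\<^sub>C ((T h x - x) /\<^sub>R h)) \<longlongrightarrow> c *\<^sub>C G x) (at_right 0)"
    by (intro bounded_linear.tendsto[OF bounded_linear_scaleC] generator_limit)
  moreover have "\<forall>\<^sub>F h in at_right 0. c *\<^sub>C ((T h x - x) /\<^sub>R h) = (T h (c *\<^sub>C x) - c *\<^sub>C x) /\<^sub>R h"
    unfolding eventually_at_filter
    by (intro always_eventually allI impI)
      (simp add: bounded_clinear_scaleC[OF bclin] linear_diff linear_scale
        bounded_linear.linear[OF bounded_linear_scaleC])
  ultimately show "((\<lambda>h. (T h (c *\<^sub>C x) - c *\<^sub>C x) /\<^sub>R h) \<longlongrightarrow> c *\<^sub>C G x) (at_right 0)"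
    by (rule Lim_transform_eventually)
qed

lemma D_scaleR: "x \<in> D \<Longrightarrow> r *\<^sub>R x \<in> D \<and> G (r *\<^sub>R x) = r *\<^sub>R G x"
  by (simp add: scaleR_scaleC D_scaleC)

lemma D_diff: "x \<in> D \<Longrightarrow> y \<in> D \<Longrightarrow> x - y \<in> D \<and> G (x - y) = G x - G y"
  using D_add[of x "(-1) *\<^sub>R y"] D_scaleR[of y "-1"] by simp

lemma D_T: "x \<in> D \<Longrightarrow> t \<ge> 0 \<Longrightarrow> T t x \<in> D \<and> G (T t x) = T t (G x)"
proof (rule generatorI)
  assume "x \<in> D" "t \<ge> 0"
  then have "((\<lambda>h. T t ((T h x - x) /\<^sub>R h)) \<longlongrightarrow> T t (G x)) (at_right 0)"
    by (intro bounded_linear.tendsto[OF blin] generator_limit)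
  moreover have "\<forall>\<^sub>F h in at_right 0. T t ((T h x - x) /\<^sub>R h) = (T h (T t x) - T t x) /\<^sub>R h"
    using \<open>t \<ge> 0\<close> by (auto simp: eventually_at_filter T_diff T_scaleR T_commute[of t])
  ultimately show "((\<lambda>h. (T h (T t x) - T t x) /\<^sub>R h) \<longlongrightarrow> T t (G x)) (at_right 0)"
    by (rule Lim_transform_eventually)
qed

lemma T_diff_min:
  assumes "s \<ge> 0" "t \<ge> 0"
  shows "norm (T s x - T t x) = norm (T (min s t) (T \<bar>s - t\<bar> x - x))"
proof (cases "s \<le> t")
  case True
  then show ?thesis
    using assms T_add[of s "t - s" x] by (simp add: T_diff norm_minus_commute)
next
  case False
  then show ?thesis
    using assms T_add[of t "s - t" x] by (simp add: T_diff)
qed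

lemma abs_diff_at_right: "filterlim (\<lambda>s. \<bar>s - t\<bar>) (at_right 0) (at t within X)" for t :: real
  unfolding filterlim_at
  by (auto simp: eventually_at_filter intro!: tendsto_eq_intros)

lemma orbit_continuous: "continuous_on {0..} (\<lambda>t. T t x)"
  unfolding continuous_on_def
proof
  fix t :: real assume t: "t \<in> {0..}"
  have "((\<lambda>s. T \<bar>s - t\<bar> x) \<longlongrightarrow> x) (at t within {0..})"
    by (rule filterlim_compose[OF T_at_0 abs_diff_at_right])
  then have "((\<lambda>s. M * norm (T \<bar>s - t\<bar> x - x)) \<longlongrightarrow> 0) (at t within {0..})"
    by (intro tendsto_mult_right_zero) (simp add: tendsto_norm_zero_iff LIM_zero_iff)
  moreover have "\<forall>\<^sub>F s in at t within {0..}. norm (T s x - T t x) \<le> M * norm (T \<bar>s - t\<bar> x - x)"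
    using t by (auto simp: eventually_at_filter T_diff_min bound)
  ultimately have "((\<lambda>s. T s x - T t x) \<longlongrightarrow> 0) (at t within {0..})"
    by (rule Lim_null_comparison[rotated])
  then show "((\<lambda>s. T s x) \<longlongrightarrow> T t x) (at t within {0..})"
    by (rule LIM_zero_cancel)
qed

lemma orbit_derivative:
  assumes x: "x \<in> D" and t: "t \<ge> 0" and X: "X \<subseteq> {0..}"
  shows "((\<lambda>s. T s x) has_vector_derivative T t (G x)) (at t within X)"
proof -
  have "((\<lambda>s. T s x) has_vector_derivative T t (G x)) (at t within {0..})"
    unfolding has_vector_derivative_iff_difference_quotient
  proof (rule Lim_transform)
    let ?q = "\<lambda>h. (T h x - x) /\<^sub>R h"
    show "((\<lambda>s. T (min s t) (G x)) \<longlongrightarrow> T t (G x)) (at t within {0..})"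
    proof -
      have "continuous_on {0..} (\<lambda>s. T (min s t) (G x))"
        using t by (intro continuous_on_compose2[OF orbit_continuous] continuous_intros) auto
      then show ?thesis
        using t by (auto simp: continuous_on_def dest!: bspec[of _ _ t])
    qed
    have "(?q \<longlongrightarrow> G x) (at_right 0)"
      by (rule generator_limit[OF x])
    then have "((\<lambda>s. ?q \<bar>s - t\<bar>) \<longlongrightarrow> G x) (at t within {0..})"
      by (rule filterlim_compose[OF _ abs_diff_at_right])
    then have "((\<lambda>s. M * norm (?q \<bar>s - t\<bar> - G x)) \<longlongrightarrow> 0) (at t within {0..})"
      by (intro tendsto_mult_right_zero) (simp add: tendsto_norm_zero_iff LIM_zero_iff)
    moreover have "\<forall>\<^sub>F s in at t within {0..}. norm ((T s x - T t x) /\<^sub>R (s - t) - T (min s t) (G x))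
        \<le> M * norm (?q \<bar>s - t\<bar> - G x)"
      unfolding eventually_at_filter
    proof (intro always_eventually allI impI)
      fix s assume s: "s \<noteq> t" "s \<in> {0..}"
      have "(T s x - T t x) /\<^sub>R (s - t) = T (min s t) (?q \<bar>s - t\<bar>)"
      proof (cases "s \<le> t")
        case True
        then have "T t x = T s (T (t - s) x)"
          using s T_add[of s "t - s" x] by simp
        moreover have "inverse (s - t) = - inverse (t - s)"
          using inverse_minus_eq[of "t - s"] by simp
        then have "(T s x - T s (T (t - s) x)) /\<^sub>R (s - t) = (T s (T (t - s) x) - T s x) /\<^sub>R (t - s)"
          by (simp add: scaleR_diff_right)
        ultimately show ?thesis
          using True s by (simp add: T_diff T_scaleR)
      next
        case False
        then have "T s x = T t (T (s - t) x)"
          using t T_add[of t "s - t" x] by simp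
        then show ?thesis
          using False t by (simp add: T_diff T_scaleR)
      qed
      then have "(T s x - T t x) /\<^sub>R (s - t) - T (min s t) (G x) = T (min s t) (?q \<bar>s - t\<bar> - G x)"
        using s t by (simp add: T_diff)
      then show "norm ((T s x - T t x) /\<^sub>R (s - t) - T (min s t) (G x)) \<le> M * norm (?q \<bar>s - t\<bar> - G x)"
        using s t by (simp add: bound)
    qed
    ultimately show "((\<lambda>s. (T s x - T t x) /\<^sub>R (s - t) - T (min s t) (G x)) \<longlongrightarrow> 0) (at t within {0..})"
      by (rule Lim_null_comparison[rotated])
  qed
  then show ?thesis
    using X by (rule has_vector_derivative_within_subset)
qed

lemma orbit_integral:
  assumes "x \<in> D" "t \<ge> 0"
  shows "((\<lambda>s. T s (G x)) has_integral (T t x - x)) {0..t}"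
  using fundamental_theorem_of_calculus[of 0 t "\<lambda>s. T s x" "\<lambda>s. T s (G x)"] assms
    orbit_derivative[of x _ "{0..t}"] by auto

lemma orbit_lipschitz:
  assumes "x \<in> D" "t \<ge> 0"
  shows "norm (T t x - x) \<le> t * M * norm (G x)"
proof -
  have "continuous_on {0..t} (\<lambda>s. T s (G x))"
    by (rule continuous_on_subset[OF orbit_continuous]) auto
  then have "norm (T t x - x) \<le> (M * norm (G x)) * (t - 0)"
    using orbit_integral[OF assms] integral_bound[of 0 t "\<lambda>s. T s (G x)" "M * norm (G x)"] assms
    by (auto simp: has_integral_iff bound)
  then show ?thesis
    by (simp add: algebra_simps)
qed

lemma orbit_average_at_0: "((\<lambda>h. integral {0..h} (\<lambda>s. T s x) /\<^sub>R h) \<longlongrightarrow> x) (at_right 0)"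
proof -
  have "((\<lambda>h. integral {0..h} (\<lambda>s. T s x)) has_vector_derivative T 0 x) (at 0 within {0..1})"
    by (intro integral_has_vector_derivative continuous_on_subset[OF orbit_continuous]) auto
  then show ?thesis
    by (simp add: has_vector_derivative_iff_difference_quotient at_within_Icc_at_right)
qed

text \<open>The average of an orbit over \<open>[0, h]\<close> lies in the domain and converges to the initial
  vector.\<close>

lemma D_dense: "closure D = UNIV"
proof -
  have "x \<in> closure D" for x
  proof -
    let ?I = "\<lambda>r. integral {0..r} (\<lambda>s. T s x)"
    have cont: "continuous_on {a..b} (\<lambda>s. T s x)" if "a \<ge> 0" for a b
      using that by (auto intro: continuous_on_subset[OF orbit_continuous])
    have I': "((\<lambda>r. (?I r - ?I a) /\<^sub>R (r - a)) \<longlongrightarrow> T a x) (at_right a)" if "a \<ge> 0" for a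
    proof -
      have "(?I has_vector_derivative T a x) (at a within {0..a+1})"
        using that by (intro integral_has_vector_derivative cont) auto
      then have "(?I has_vector_derivative T a x) (at a within {a..a+1})"
        by (rule has_vector_derivative_within_subset) (use that in auto)
      then have "(?I has_vector_derivative T a x) (at_right a)"
        by (simp add: has_vector_derivative_iff_difference_quotient at_within_Icc_at_right)
      then show ?thesis
        by (simp add: has_vector_derivative_iff_difference_quotient)
    qed
    have D: "?I h \<in> D" if h: "h > 0" for h
    proof -
      have "((\<lambda>r. (?I (h + r) - ?I h) /\<^sub>R r - (?I r - ?I 0) /\<^sub>R r) \<longlongrightarrow> T h x - T 0 x) (at_right 0)"
      proof (intro tendsto_diff)
        show "((\<lambda>r. (?I (h + r) - ?I h) /\<^sub>R r) \<longlongrightarrow> T h x) (at_right 0)"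
          using I'[of h] h filterlim_at_right_to_0[of "\<lambda>r. (?I r - ?I h) /\<^sub>R (r - h)" "nhds (T h x)" h]
          by (simp add: add.commute)
        show "((\<lambda>r. (?I r - ?I 0) /\<^sub>R r) \<longlongrightarrow> T 0 x) (at_right 0)"
          using I'[of 0] by simp
      qed
      moreover have "\<forall>\<^sub>F r in at_right 0.
          (?I (h + r) - ?I h) /\<^sub>R r - (?I r - ?I 0) /\<^sub>R r = (T r (?I h) - ?I h) /\<^sub>R r"
        unfolding eventually_at_filter
      proof (intro always_eventually allI impI)
        fix r :: real assume "r \<in> {0<..}"
        then have r: "r > 0" by simp
        have "T r (?I h) = integral {0..h} (T r \<circ> (\<lambda>s. T s x))"
          using r h by (intro integral_linear[symmetric] integrable_continuous_interval cont blin) auto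
        also have "\<dots> = integral {0..h} ((\<lambda>s. T s x) \<circ> (+) r)"
          using r by (intro integral_cong) (auto simp: T_add)
        also have "\<dots> = integral {r..h+r} (\<lambda>s. T s x)"
          using integral_shift_Icc_real[of 0 h "\<lambda>s. T s x" r] by simp
        also have "\<dots> = ?I (h + r) - ?I r"
          using Henstock_Kurzweil_Integration.integral_combine[of 0 r "h + r" "\<lambda>s. T s x"] r h
          by (auto simp: algebra_simps integrable_continuous_interval cont)
        finally show "(?I (h + r) - ?I h) /\<^sub>R r - (?I r - ?I 0) /\<^sub>R r = (T r (?I h) - ?I h) /\<^sub>R r"
          by (simp add: scaleR_diff_right)
      qed
      ultimately show ?thesis
        using generatorI[of "?I h"] by (blast intro: Lim_transform_eventually)
    qed
    have "\<forall>\<^sub>F h in at_right 0. ?I h /\<^sub>R h \<in> closure D"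
      using D D_scaleR closure_subset[of D] by (auto simp: eventually_at_filter subset_iff)
    then show ?thesis
      by (rule Lim_in_closed_set[OF closed_closure _ _ orbit_average_at_0])
        (auto simp: trivial_limit_at_right_real)
  qed
  then show ?thesis by auto
qed

lemma D_sequence:
  obtains X where "\<And>n. X n \<in> D" "X \<longlonglongrightarrow> x"
  using D_dense closure_sequential[of x D] by auto

text \<open>The generator is closed: pass to the limit in \<open>T h x - x = \<integral> T s (G x) ds\<close>.\<close>

lemma generator_closed:
  assumes X: "\<And>n. X n \<in> D" and lim: "X \<longlonglongrightarrow> x" and Glim: "(\<lambda>n. G (X n)) \<longlonglongrightarrow> y"
  shows "x \<in> D \<and> G x = y"
proof (rule generatorI)
  let ?I = "\<lambda>r. integral {0..r} (\<lambda>s. T s y)"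
  have cont: "continuous_on {a..b} (\<lambda>s. T s z)" if "a \<ge> 0" for a b z
    using that by (auto intro: continuous_on_subset[OF orbit_continuous])
  have eq: "T h x - x = ?I h" if h: "h \<ge> 0" for h
  proof -
    have "(\<lambda>n. T h (X n) - X n) \<longlonglongrightarrow> T h x - x"
      using h by (intro tendsto_diff bounded_linear.tendsto[OF blin] lim)
    moreover have "(\<lambda>n. T h (X n) - X n) \<longlonglongrightarrow> ?I h"
    proof -
      have "norm ((T h (X n) - X n) - ?I h) \<le> h * M * norm (G (X n) - y)" for n
      proof -
        have "T h (X n) - X n = integral {0..h} (\<lambda>s. T s (G (X n)))"
          using orbit_integral[OF X h, of n] by (simp add: has_integral_iff)
        then have "(T h (X n) - X n) - ?I h = integral {0..h} (\<lambda>s. T s (G (X n)) - T s y)"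
          by (simp add: integral_diff integrable_continuous_interval cont)
        also have "norm \<dots> \<le> (M * norm (G (X n) - y)) * (h - 0)"
        proof (rule integral_bound)
          show "norm (T t (G (X n)) - T t y) \<le> M * norm (G (X n) - y)" if "t \<in> {0..h}" for t
            using that bound[of t "G (X n) - y"] by (simp add: T_diff)
        qed (use h in \<open>auto intro!: continuous_intros cont\<close>)
        finally show ?thesis by (simp add: algebra_simps)
      qed
      then have "\<forall>\<^sub>F n in sequentially. norm ((T h (X n) - X n) - ?I h) \<le> h * M * norm (G (X n) - y)"
        by (simp add: always_eventually)
      moreover have "(\<lambda>n. h * M * norm (G (X n) - y)) \<longlonglongrightarrow> 0"
        using Glim by (intro tendsto_mult_right_zero) (simp add: tendsto_norm_zero_iff LIM_zero_iff)
      ultimately have "(\<lambda>n. (T h (X n) - X n) - ?I h) \<longlonglongrightarrow> 0"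
        by (rule Lim_null_comparison)
      then show ?thesis
        by (rule LIM_zero_cancel)
    qed
    ultimately show ?thesis
      using LIMSEQ_unique by blast
  qed
  have "\<forall>\<^sub>F h in at_right 0. ?I h /\<^sub>R h = (T h x - x) /\<^sub>R h"
    using eq by (auto simp: eventually_at_filter)
  then show "((\<lambda>h. (T h x - x) /\<^sub>R h) \<longlongrightarrow> y) (at_right 0)"
    by (rule Lim_transform_eventually[OF orbit_average_at_0])
qed

end

section \<open>Weighted orbit integrals\<close>

definition exp_kernel :: "(real \<Rightarrow> real) \<Rightarrow> bool" where
  "exp_kernel k \<longleftrightarrow> continuous_on {0..} k \<and> (\<exists>C \<nu>. \<nu> > 0 \<and> (\<forall>s\<ge>0. \<bar>k s\<bar> \<le> C * exp (- \<nu> * s)))"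

lemma exp_kernelI:
  "continuous_on {0..} k \<Longrightarrow> \<nu> > 0 \<Longrightarrow> (\<And>s. s \<ge> 0 \<Longrightarrow> \<bar>k s\<bar> \<le> C * exp (- \<nu> * s)) \<Longrightarrow> exp_kernel k"
  by (auto simp: exp_kernel_def)

lemma exp_kernelE:
  assumes "exp_kernel k"
  obtains C \<nu> where "continuous_on {0..} k" "C \<ge> 0" "\<nu> > 0"
    "\<And>s. s \<ge> 0 \<Longrightarrow> \<bar>k s\<bar> \<le> C * exp (- \<nu> * s)"
proof -
  obtain C \<nu> where *: "continuous_on {0..} k" "\<nu> > 0" "\<And>s. s \<ge> 0 \<Longrightarrow> \<bar>k s\<bar> \<le> C * exp (- \<nu> * s)"
    using assms by (auto simp: exp_kernel_def)
  moreover have "C \<ge> 0"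
    using *(3)[of 0] abs_ge_zero[of "k 0"] by (simp del: abs_ge_zero)
  ultimately show ?thesis
    using that by blast
qed

lemma exp_kernel_cong: "(\<And>s. s \<ge> 0 \<Longrightarrow> k s = l s) \<Longrightarrow> exp_kernel k \<longleftrightarrow> exp_kernel l"
  unfolding exp_kernel_def using continuous_on_cong[of "{0..}" "{0..}" k l] by auto

lemma exp_kernel_tendsto_0:
  assumes "exp_kernel k"
  shows "(k \<longlongrightarrow> 0) at_top"
proof -
  obtain C \<nu> where *: "\<nu> > 0" "\<And>s. s \<ge> 0 \<Longrightarrow> \<bar>k s\<bar> \<le> C * exp (- \<nu> * s)"
    by (rule exp_kernelE[OF assms]) blast
  have "((\<lambda>s. C * exp (- \<nu> * s)) \<longlongrightarrow> 0) at_top"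
    using *(1)
    by (intro tendsto_mult_right_zero filterlim_compose[OF exp_at_bot]
          filterlim_tendsto_neg_mult_at_bot[OF tendsto_const] filterlim_ident) auto
  moreover have "\<forall>\<^sub>F s in at_top. norm (k s) \<le> C * exp (- \<nu> * s)"
    using *(2) by (auto intro!: eventually_at_top_linorderI[of 0])
  ultimately show ?thesis
    by (rule Lim_null_comparison[rotated])
qed

lemma exp_kernel_scale: "exp_kernel k \<Longrightarrow> exp_kernel (\<lambda>s. c * k s)"
proof (erule exp_kernelE)
  fix C \<nu>
  assume *: "continuous_on {0..} k" "\<nu> > 0" "\<And>s. s \<ge> 0 \<Longrightarrow> \<bar>k s\<bar> \<le> C * exp (- \<nu> * s)"
  show ?thesis
  proof (rule exp_kernelI[OF _ *(2)])
    show "\<bar>c * k s\<bar> \<le> (\<bar>c\<bar> * C) * exp (- \<nu> * s)" if "s \<ge> 0" for s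
      using mult_left_mono[OF *(3)[OF that], of "\<bar>c\<bar>"] by (simp add: abs_mult mult.assoc)
  qed (intro continuous_intros *)
qed

lemma exp_kernel_add: 
  assumes "exp_kernel k" "exp_kernel l"
  shows "exp_kernel (\<lambda>s. k s + l s)"
proof -
  obtain C \<nu> where k: "continuous_on {0..} k" "C \<ge> 0" "\<nu> > 0" "\<And>s. s \<ge> 0 \<Longrightarrow> \<bar>k s\<bar> \<le> C * exp (- \<nu> * s)"
    by (rule exp_kernelE[OF assms(1)]) blast
  obtain C' \<nu>' where l: "continuous_on {0..} l" "C' \<ge> 0" "\<nu>' > 0" "\<And>s. s \<ge> 0 \<Longrightarrow> \<bar>l s\<bar> \<le> C' * exp (- \<nu>' * s)"
    by (rule exp_kernelE[OF assms(2)]) blast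
  show ?thesis
  proof (rule exp_kernelI)
    show "min \<nu> \<nu>' > 0" using k l by simp
    show "\<bar>k s + l s\<bar> \<le> (C + C') * exp (- min \<nu> \<nu>' * s)" if s: "s \<ge> 0" for s
    proof -
      have "C * exp (- \<nu> * s) \<le> C * exp (- min \<nu> \<nu>' * s)" "C' * exp (- \<nu>' * s) \<le> C' * exp (- min \<nu> \<nu>' * s)"
        using k l s by (auto intro!: mult_left_mono mult_right_mono)
      then show ?thesis
        using k(4)[OF s] l(4)[OF s] by (simp add: distrib_right)
    qed
  qed (intro continuous_intros k l)
qed

lemma exp_kernel_exp: "\<mu> > 0 \<Longrightarrow> exp_kernel (\<lambda>s. exp (- \<mu> * s))"
  by (rule exp_kernelI[where C = 1 and \<nu> = \<mu>]) (auto intro!: continuous_intros)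

lemma powr_exp_bound:
  fixes a \<mu> s :: real
  assumes "a > 0" "\<mu> > 0" "s \<ge> 0"
  shows "s powr a * exp (- \<mu> * s) \<le> (2 * a / \<mu>) powr a * exp (- (\<mu> / 2) * s)"
proof -
  let ?y = "\<mu> * s / (2 * a)"
  have y: "?y \<le> exp ?y" "?y \<ge> 0"
    using assms exp_ge_add_one_self[of ?y] by (auto simp del: exp_ge_add_one_self)
  have "s powr a = (2 * a / \<mu> * ?y) powr a"
    using assms by simp
  also have "\<dots> = (2 * a / \<mu>) powr a * ?y powr a"
    by (rule powr_mult)
  also have "\<dots> \<le> (2 * a / \<mu>) powr a * exp ?y powr a"
    using assms y by (intro mult_left_mono powr_mono2) auto
  also have "exp ?y powr a = exp (\<mu> / 2 * s)"
    using assms by (simp add: powr_def)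
  finally have "s powr a * exp (- \<mu> * s) \<le> (2 * a / \<mu>) powr a * exp (\<mu> / 2 * s) * exp (- \<mu> * s)"
    by (rule mult_right_mono) simp
  also have "\<dots> = (2 * a / \<mu>) powr a * exp (- (\<mu> / 2) * s)"
    by (simp add: mult.assoc flip: exp_add)
  finally show ?thesis .
qed

lemma exp_kernel_powr: "a > 0 \<Longrightarrow> \<mu> > 0 \<Longrightarrow> exp_kernel (\<lambda>s. s powr a * exp (- \<mu> * s))"
  by (rule exp_kernelI[where C = "(2 * a / \<mu>) powr a" and \<nu> = "\<mu> / 2"])
    (auto intro!: continuous_intros continuous_on_powr' simp: powr_exp_bound[simplified])

lemma exp_kernel_power: "\<mu> > 0 \<Longrightarrow> exp_kernel (\<lambda>s. s ^ m * exp (- \<mu> * s))"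
proof (cases m)
  case (Suc n)
  assume mu: "\<mu> > 0"
  have "s powr m = s ^ m" if "s \<ge> 0" for s :: real
    using that Suc by (cases "s = 0") (auto simp: powr_realpow simp del: of_nat_Suc)
  then show ?thesis
    using exp_kernel_powr[of "real m" \<mu>] Suc mu
      exp_kernel_cong[of "\<lambda>s. s powr m * exp (- \<mu> * s)" "\<lambda>s. s ^ m * exp (- \<mu> * s)"]
    by (simp del: of_nat_Suc)
qed (use exp_kernel_exp in simp)

lemma has_integral_extend_by_zero:
  fixes f :: "real \<Rightarrow> 'a::banach"
  assumes "(f has_integral i) S" "S \<subseteq> T" "\<And>x. x \<in> T - S \<Longrightarrow> f x = 0"
  shows "(f has_integral i) T"
proof -
  have "((\<lambda>x. if x \<in> S then f x else 0) has_integral i) T"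
    using assms by (simp add: has_integral_restrict)
  then show ?thesis
    by (rule has_integral_eq[rotated]) (use assms in auto)
qed

context bounded_C0_semigroup
begin

text \<open>The functional calculus of Hille and Phillips for the generator: the weight
  \<open>s\<^bsup>a - 1\<^esup> e\<^bsup>-\<mu>s\<^esup> / \<Gamma>(a)\<close> gives \<open>(\<mu> - G)\<^bsup>-a\<^esup>\<close>.\<close>

definition orbit_mean :: "(real \<Rightarrow> real) \<Rightarrow> 'a \<Rightarrow> 'a" where
  "orbit_mean k x = integral {0..} (\<lambda>s. k s *\<^sub>R T s x)"

lemma weighted_orbit_continuous: "continuous_on {0..} k \<Longrightarrow> continuous_on {0..} (\<lambda>s. k s *\<^sub>R T s x)"
  by (intro continuous_intros orbit_continuous)

lemma weighted_orbit_bound: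
  assumes "\<And>s. s \<ge> 0 \<Longrightarrow> \<bar>k s\<bar> \<le> C * exp (- \<nu> * s)" "s \<ge> 0"
  shows "norm (k s *\<^sub>R T s x) \<le> (C * M * norm x) * exp (- \<nu> * s)"
proof -
  have "\<bar>k s\<bar> * norm (T s x) \<le> (C * exp (- \<nu> * s)) * (M * norm x)"
    using assms(1)[OF assms(2)] bound[OF assms(2), of x] order_trans[OF abs_ge_zero assms(1)[OF assms(2)]]
    by (intro mult_mono) auto
  then show ?thesis
    by (simp add: mult_ac)
qed

lemma orbit_mean_integrable:
  assumes "exp_kernel k"
  shows "(\<lambda>s. k s *\<^sub>R T s x) integrable_on {0..}"
    and "((\<lambda>b. integral {0..b} (\<lambda>s. k s *\<^sub>R T s x)) \<longlongrightarrow> orbit_mean k x) at_top"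
proof -
  obtain C \<nu> where k: "continuous_on {0..} k" "\<nu> > 0" "\<And>s. s \<ge> 0 \<Longrightarrow> \<bar>k s\<bar> \<le> C * exp (- \<nu> * s)"
    by (rule exp_kernelE[OF assms]) blast
  note * = exp_bounded_integral_halfline[OF weighted_orbit_continuous[OF k(1)] k(2) weighted_orbit_bound[OF k(3)]]
  show "(\<lambda>s. k s *\<^sub>R T s x) integrable_on {0..}"
    and "((\<lambda>b. integral {0..b} (\<lambda>s. k s *\<^sub>R T s x)) \<longlongrightarrow> orbit_mean k x) at_top"
    using *(1,2) by (auto simp: orbit_mean_def)
qed

lemma orbit_mean_bound:
  assumes "exp_kernel k"
  obtains C where "C \<ge> 0" "\<And>x. norm (orbit_mean k x) \<le> C * norm x"
proof -
  obtain C \<nu> where k: "continuous_on {0..} k" "C \<ge> 0" "\<nu> > 0" "\<And>s. s \<ge> 0 \<Longrightarrow> \<bar>k s\<bar> \<le> C * exp (- \<nu> * s)"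
    by (rule exp_kernelE[OF assms]) blast
  have "norm (orbit_mean k x) \<le> (C * M / \<nu>) * norm x" for x
    using exp_bounded_integral_halfline(4)[OF weighted_orbit_continuous[OF k(1)] k(3) weighted_orbit_bound[OF k(4)]]
    by (simp add: orbit_mean_def)
  then show ?thesis
    using that[of "C * M / \<nu>"] k M_ge_1 by simp
qed

lemma orbit_mean_linear:
  assumes "exp_kernel k"
  shows "bounded_linear (orbit_mean k)"
proof -
  obtain C where C: "C \<ge> 0" "\<And>x. norm (orbit_mean k x) \<le> C * norm x"
    by (rule orbit_mean_bound[OF assms]) blast
  show ?thesis
  proof (rule bounded_linear_intro[where K = C])
    show "orbit_mean k (x + y) = orbit_mean k x + orbit_mean k y" for x y
      unfolding orbit_mean_def
      by (subst integral_add[symmetric])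
        (auto intro!: integral_cong orbit_mean_integrable assms simp: T_plus scaleR_add_right)
    show "orbit_mean k (r *\<^sub>R x) = r *\<^sub>R orbit_mean k x" for r x
      unfolding orbit_mean_def
      by (subst integral_cmul[symmetric]) (auto intro!: integral_cong simp: T_scaleR)
  qed (simp add: C mult.commute)
qed

lemma orbit_mean_commute:
  assumes "exp_kernel k" "t \<ge> 0"
  shows "T t (orbit_mean k x) = orbit_mean k (T t x)"
proof -
  have "T t (orbit_mean k x) = integral {0..} (T t \<circ> (\<lambda>s. k s *\<^sub>R T s x))"
    unfolding orbit_mean_def
    by (rule integral_linear[symmetric, OF orbit_mean_integrable(1)[OF assms(1)] blin[OF assms(2)]])
  also have "\<dots> = orbit_mean k (T t x)"
    unfolding orbit_mean_def by (rule integral_cong) (use assms in \<open>auto simp: T_scaleR T_commute\<close>)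
  finally show ?thesis .
qed

lemma orbit_mean_kernel_scale: "orbit_mean (\<lambda>s. c * k s) x = c *\<^sub>R orbit_mean k x"
  unfolding orbit_mean_def by (subst integral_cmul[symmetric]) simp

lemma orbit_mean_kernel_add:
  "exp_kernel k \<Longrightarrow> exp_kernel l \<Longrightarrow> orbit_mean (\<lambda>s. k s + l s) x = orbit_mean k x + orbit_mean l x"
  unfolding orbit_mean_def
  by (subst integral_add[symmetric]) (auto intro!: orbit_mean_integrable simp: scaleR_add_left)

text \<open>Integration by parts. The derivative of the weight is allowed to be singular at \<open>0\<close>; this
  is how a fractional power with exponent below \<open>1\<close> becomes an integral with a continuous
  weight.\<close>

lemma orbit_mean_by_parts:
  assumes k: "exp_kernel k" and k': "\<And>s. s > 0 \<Longrightarrow> (k has_real_derivative k' s) (at s)"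
    and x: "x \<in> D"
  shows "((\<lambda>s. k' s *\<^sub>R T s x) has_integral (- k 0 *\<^sub>R x - orbit_mean k (G x))) {0..}"
proof -
  have cont: "continuous_on {0..} k"
    using k by (auto simp: exp_kernel_def)
  have int: "((\<lambda>s. k' s *\<^sub>R T s x) has_integral
      (k b *\<^sub>R T b x - k 0 *\<^sub>R x - integral {0..b} (\<lambda>s. k s *\<^sub>R T s (G x)))) {0..b}"
    if b: "b \<ge> 0" for b
  proof -
    have "((\<lambda>s. k s *\<^sub>R T s (G x) + k' s *\<^sub>R T s x) has_integral (k b *\<^sub>R T b x - k 0 *\<^sub>R T 0 x)) {0..b}"
    proof (rule fundamental_theorem_of_calculus_interior[OF b])
      show "continuous_on {0..b} (\<lambda>s. k s *\<^sub>R T s x)"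
        by (rule continuous_on_subset[OF weighted_orbit_continuous[OF cont]]) auto
      fix s assume s: "s \<in> {0<..<b}"
      have "((\<lambda>s. T s x) has_vector_derivative T s (G x)) (at s within {0<..})"
        using s by (intro orbit_derivative[OF x]) auto
      then have "((\<lambda>s. T s x) has_vector_derivative T s (G x)) (at s)"
        using s at_within_open[of s "{0<..}"] by auto
      then show "((\<lambda>s. k s *\<^sub>R T s x) has_vector_derivative k s *\<^sub>R T s (G x) + k' s *\<^sub>R T s x) (at s)"
        using s by (intro has_vector_derivative_scaleR[OF k']) auto
    qed
    moreover have "(\<lambda>s. k s *\<^sub>R T s (G x)) integrable_on {0..b}"
      by (intro integrable_continuous_interval continuous_on_subset[OF weighted_orbit_continuous[OF cont]]) auto
    ultimately have "((\<lambda>s. (k s *\<^sub>R T s (G x) + k' s *\<^sub>R T s x) - k s *\<^sub>R T s (G x)) has_integral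
        (k b *\<^sub>R T b x - k 0 *\<^sub>R T 0 x) - integral {0..b} (\<lambda>s. k s *\<^sub>R T s (G x))) {0..b}"
      by (intro has_integral_diff integrable_integral)
    then show ?thesis
      by simp
  qed
  have kT: "((\<lambda>b. k b *\<^sub>R T b x) \<longlongrightarrow> 0) at_top"
  proof (rule Lim_null_comparison)
    show "\<forall>\<^sub>F b in at_top. norm (k b *\<^sub>R T b x) \<le> \<bar>k b\<bar> * (M * norm x)"
      by (rule eventually_at_top_linorderI[of 0]) (auto intro!: mult_left_mono bound)
    show "((\<lambda>b. \<bar>k b\<bar> * (M * norm x)) \<longlongrightarrow> 0) at_top"
      using exp_kernel_tendsto_0[OF k] by (intro tendsto_mult_left_zero tendsto_rabs_zero)
  qed
  show ?thesis
  proof (rule has_integral_halfline)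
    show "(\<lambda>s. k' s *\<^sub>R T s x) integrable_on {0..b}" if "b \<ge> 0" for b
      using int[OF that] by blast
    have "((\<lambda>b. k b *\<^sub>R T b x - k 0 *\<^sub>R x - integral {0..b} (\<lambda>s. k s *\<^sub>R T s (G x))) \<longlongrightarrow>
        0 - k 0 *\<^sub>R x - orbit_mean k (G x)) at_top"
      by (intro tendsto_diff kT tendsto_const orbit_mean_integrable[OF k])
    moreover have "\<forall>\<^sub>F b in at_top. k b *\<^sub>R T b x - k 0 *\<^sub>R x - integral {0..b} (\<lambda>s. k s *\<^sub>R T s (G x)) =
        integral {0..b} (\<lambda>s. k' s *\<^sub>R T s x)"
      using int by (auto intro!: eventually_at_top_linorderI[of 0] simp: has_integral_iff)
    ultimately show "((\<lambda>b. integral {0..b} (\<lambda>s. k' s *\<^sub>R T s x)) \<longlongrightarrow> - k 0 *\<^sub>R x - orbit_mean k (G x)) at_top"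
      using Lim_transform_eventually[of _ "- k 0 *\<^sub>R x - orbit_mean k (G x)"] by simp
  qed
qed

text \<open>For a differentiable weight the mean takes every vector into the domain: on the domain
  this is integration by parts, and the general case follows because the domain is dense and the
  generator closed.\<close>

lemma orbit_mean_generator:
  assumes k: "exp_kernel k" and k': "exp_kernel k'" "\<And>s. s > 0 \<Longrightarrow> (k has_real_derivative k' s) (at s)"
  shows "orbit_mean k x \<in> D \<and> G (orbit_mean k x) = - k 0 *\<^sub>R x - orbit_mean k' x"
proof -
  interpret k: bounded_linear "orbit_mean k" by (rule orbit_mean_linear[OF k])
  interpret k': bounded_linear "orbit_mean k'" by (rule orbit_mean_linear[OF k'(1)])
  have on_D: "orbit_mean k x \<in> D \<and> G (orbit_mean k x) = - k 0 *\<^sub>R x - orbit_mean k' x" if x: "x \<in> D" for x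
  proof -
    have "((\<lambda>h. orbit_mean k ((T h x - x) /\<^sub>R h)) \<longlongrightarrow> orbit_mean k (G x)) (at_right 0)"
      by (intro k.tendsto generator_limit x)
    moreover have "\<forall>\<^sub>F h in at_right 0. orbit_mean k ((T h x - x) /\<^sub>R h) = (T h (orbit_mean k x) - orbit_mean k x) /\<^sub>R h"
      by (auto simp: eventually_at_filter k.diff k.scaleR orbit_mean_commute[OF k])
    ultimately have "((\<lambda>h. (T h (orbit_mean k x) - orbit_mean k x) /\<^sub>R h) \<longlongrightarrow> orbit_mean k (G x)) (at_right 0)"
      by (rule Lim_transform_eventually)
    moreover have "orbit_mean k' x = - k 0 *\<^sub>R x - orbit_mean k (G x)"
      using orbit_mean_by_parts[OF k k'(2) x] by (simp add: orbit_mean_def has_integral_iff)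
    ultimately show ?thesis
      using generatorI by (simp add: algebra_simps)
  qed
  obtain X where X: "\<And>n. X n \<in> D" "X \<longlonglongrightarrow> x"
    by (rule D_sequence[of x]) blast
  show ?thesis
  proof (rule generator_closed)
    show "orbit_mean k (X n) \<in> D" for n
      using on_D X by blast
    show "(\<lambda>n. orbit_mean k (X n)) \<longlonglongrightarrow> orbit_mean k x"
      by (intro k.tendsto X)
    have "(\<lambda>n. - k 0 *\<^sub>R X n - orbit_mean k' (X n)) \<longlonglongrightarrow> - k 0 *\<^sub>R x - orbit_mean k' x"
      by (intro tendsto_intros k'.tendsto X)
    then show "(\<lambda>n. G (orbit_mean k (X n))) \<longlonglongrightarrow> - k 0 *\<^sub>R x - orbit_mean k' x"
      using on_D X by simp
  qed
qed

definition resolvent :: "real \<Rightarrow> 'a \<Rightarrow> 'a" where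
  "resolvent \<mu> = orbit_mean (\<lambda>s. exp (- \<mu> * s))"

lemma resolvent_in_D:
  assumes "\<mu> > 0"
  shows "resolvent \<mu> x \<in> D \<and> G (resolvent \<mu> x) = \<mu> *\<^sub>R resolvent \<mu> x - x"
proof -
  have "((\<lambda>s. exp (- \<mu> * s)) has_real_derivative - \<mu> * exp (- \<mu> * s)) (at s)" for s
    by (auto intro!: derivative_eq_intros)
  then show ?thesis
    using orbit_mean_generator[OF exp_kernel_exp[OF assms] exp_kernel_scale[OF exp_kernel_exp[OF assms]], of "- \<mu>" x]
      orbit_mean_kernel_scale[of "- \<mu>" "\<lambda>s. exp (- \<mu> * s)" x]
    by (simp add: resolvent_def)
qed

lemma resolvent_left_inverse:
  assumes mu: "\<mu> > 0" and x: "x \<in> D"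
  shows "resolvent \<mu> (\<mu> *\<^sub>R x - G x) = x"
proof -
  interpret R: bounded_linear "resolvent \<mu>"
    unfolding resolvent_def by (rule orbit_mean_linear[OF exp_kernel_exp[OF mu]])
  have "((\<lambda>s. exp (- \<mu> * s)) has_real_derivative - \<mu> * exp (- \<mu> * s)) (at s)" for s
    by (auto intro!: derivative_eq_intros)
  then have "orbit_mean (\<lambda>s. - \<mu> * exp (- \<mu> * s)) x = - x - resolvent \<mu> (G x)"
    using orbit_mean_by_parts[OF exp_kernel_exp[OF mu] _ x, of "\<lambda>s. - \<mu> * exp (- \<mu> * s)"]
    by (simp add: orbit_mean_def resolvent_def has_integral_iff)
  then have "- \<mu> *\<^sub>R resolvent \<mu> x = - x - resolvent \<mu> (G x)"
    using orbit_mean_kernel_scale[of "- \<mu>" "\<lambda>s. exp (- \<mu> * s)" x] by (simp add: resolvent_def)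
  then show ?thesis
    by (simp add: R.diff R.scaleR algebra_simps)
qed

text \<open>Composition of means is convolution of weights. Extending the inner weight by \<open>0\<close> to the
  negative axis turns the triangle \<open>0 \<le> s \<le> v \<le> a\<close> into a square with a continuous integrand, on
  which the order of integration may be exchanged; what is left out for finite \<open>a\<close> decays like
  \<open>a e\<^bsup>-\<nu>a\<^esup>\<close>.\<close>

lemma orbit_mean_convolution:
  assumes k: "exp_kernel k" and l: "exp_kernel l" "l 0 = 0" and q: "exp_kernel q"
    and conv: "\<And>v. v \<ge> 0 \<Longrightarrow> ((\<lambda>s. k s * l (v - s)) has_integral q v) {0..v}"
  shows "orbit_mean k (orbit_mean l x) = orbit_mean q x"
proof -
  obtain C \<nu>1 where k': "continuous_on {0..} k" "C \<ge> 0" "\<nu>1 > 0" "\<And>s. s \<ge> 0 \<Longrightarrow> \<bar>k s\<bar> \<le> C * exp (- \<nu>1 * s)"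
    by (rule exp_kernelE[OF k]) blast
  obtain C' \<nu>2 where l': "continuous_on {0..} l" "C' \<ge> 0" "\<nu>2 > 0" "\<And>s. s \<ge> 0 \<Longrightarrow> \<bar>l s\<bar> \<le> C' * exp (- \<nu>2 * s)"
    by (rule exp_kernelE[OF l(1)]) blast
  define \<nu> where "\<nu> = min \<nu>1 \<nu>2"
  have nu: "\<nu> > 0"
    using k' l' by (simp add: \<nu>_def)
  have kb: "\<bar>k s\<bar> \<le> C * exp (- \<nu> * s)" if s: "s \<ge> 0" for s
  proof -
    have "C * exp (- \<nu>1 * s) \<le> C * exp (- \<nu> * s)"
      using k' s by (auto intro!: mult_left_mono mult_right_mono simp: \<nu>_def)
    then show ?thesis using k'(4)[OF s] by simp
  qed
  have lb: "\<bar>l s\<bar> \<le> C' * exp (- \<nu> * s)" if s: "s \<ge> 0" for s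
  proof -
    have "C' * exp (- \<nu>2 * s) \<le> C' * exp (- \<nu> * s)"
      using l' s by (auto intro!: mult_left_mono mult_right_mono simp: \<nu>_def)
    then show ?thesis using l'(4)[OF s] by simp
  qed
  define lp where "lp s = l (max 0 s)" for s
  have lp_cont: "continuous_on UNIV lp"
    unfolding lp_def by (intro continuous_on_compose2[OF l'(1)] continuous_intros) auto
  have lp_neg: "lp s = 0" if "s \<le> 0" for s
    using that l by (simp add: lp_def max_def)
  have lp_pos: "lp s = l s" if "s \<ge> 0" for s
    using that by (simp add: lp_def)
  let ?W = "orbit_mean l x"
  define I where "I a = integral {0..a} (\<lambda>s. integral {0..a} (\<lambda>v. (k s * lp (v - s)) *\<^sub>R T v x))" for a
  have cont2: "continuous_on (cbox (0, 0) (a, a)) (\<lambda>(s, v). (k s * lp (v - s)) *\<^sub>R T v x)" for a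
  proof -
    have "continuous_on (cbox (0::real, 0::real) (a, a)) (\<lambda>z. (k (fst z) * lp (snd z - fst z)) *\<^sub>R T (snd z) x)"
      by (intro continuous_intros continuous_on_compose2[OF k'(1)] continuous_on_compose2[OF lp_cont]
          continuous_on_compose2[OF orbit_continuous]) (auto simp: cbox_Pair_eq)
    then show ?thesis
      by (simp add: case_prod_unfold)
  qed
  have swap: "I a = integral {0..a} (\<lambda>v. q v *\<^sub>R T v x)" if a: "a \<ge> 0" for a
  proof -
    have "I a = integral {0..a} (\<lambda>v. integral {0..a} (\<lambda>s. (k s * lp (v - s)) *\<^sub>R T v x))"
      unfolding I_def using integral_swap_continuous[OF cont2[of a]] by simp
    also have "\<dots> = integral {0..a} (\<lambda>v. q v *\<^sub>R T v x)"
    proof (rule integral_cong)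
      fix v assume v: "v \<in> {0..a}"
      have "((\<lambda>s. k s * lp (v - s)) has_integral q v) {0..v}"
        using conv[of v] v lp_pos by (auto elim!: has_integral_eq[rotated])
      then have "((\<lambda>s. k s * lp (v - s)) has_integral q v) {0..a}"
        by (rule has_integral_extend_by_zero) (use v lp_neg in auto)
      then have "((\<lambda>s. (k s * lp (v - s)) *\<^sub>R T v x) has_integral q v *\<^sub>R T v x) {0..a}"
        by (rule has_integral_scaleR_left)
      then show "integral {0..a} (\<lambda>s. (k s * lp (v - s)) *\<^sub>R T v x) = q v *\<^sub>R T v x"
        by (rule integral_unique)
    qed
    finally show ?thesis .
  qed
  have inner: "integral {0..a} (\<lambda>v. (k s * lp (v - s)) *\<^sub>R T v x) =
      k s *\<^sub>R T s (integral {0..a - s} (\<lambda>r. l r *\<^sub>R T r x))" if s: "0 \<le> s" "s \<le> a" for s a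
  proof -
    have cl: "continuous_on {0..a - s} (\<lambda>r. l r *\<^sub>R T r x)"
      by (rule continuous_on_subset[OF weighted_orbit_continuous[OF l'(1)]]) auto
    have "((\<lambda>r. l r *\<^sub>R T r x) has_integral integral {0..a - s} (\<lambda>r. l r *\<^sub>R T r x)) {0..a - s}"
      by (intro integrable_integral integrable_continuous_interval cl)
    then have "(((\<lambda>z. k s *\<^sub>R T s z) \<circ> (\<lambda>r. l r *\<^sub>R T r x)) has_integral
        k s *\<^sub>R T s (integral {0..a - s} (\<lambda>r. l r *\<^sub>R T r x))) {0..a - s}"
      by (rule has_integral_linear)
        (use s in \<open>intro bounded_linear_compose[OF bounded_linear_scaleR_right] blin; simp\<close>)
    then have "((\<lambda>r. (k s * lp ((r + s) - s)) *\<^sub>R T (r + s) x) has_integral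
        k s *\<^sub>R T s (integral {0..a - s} (\<lambda>r. l r *\<^sub>R T r x))) {0..a - s}"
      by (rule has_integral_eq[rotated])
        (use s in \<open>auto simp: lp_pos T_scaleR add.commute[of _ s] T_add\<close>)
    then have "((\<lambda>v. (k s * lp (v - s)) *\<^sub>R T v x) has_integral
        k s *\<^sub>R T s (integral {0..a - s} (\<lambda>r. l r *\<^sub>R T r x))) {s..a}"
      using has_integral_shift_real_ivl_iff[of "\<lambda>v. (k s * lp (v - s)) *\<^sub>R T v x" _ s a s] by simp
    then have "((\<lambda>v. (k s * lp (v - s)) *\<^sub>R T v x) has_integral
        k s *\<^sub>R T s (integral {0..a - s} (\<lambda>r. l r *\<^sub>R T r x))) {0..a}"
      by (rule has_integral_extend_by_zero) (use s lp_neg in auto)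
    then show ?thesis
      by (rule integral_unique)
  qed
  define N where "N = C * (M * (C' * M * norm x / \<nu>))"
  have diff: "norm (I a - integral {0..a} (\<lambda>s. k s *\<^sub>R T s ?W)) \<le> N * exp (- \<nu> * a) * a"
    if a: "a \<ge> 0" for a
  proof -
    let ?w = "\<lambda>s. integral {0..a - s} (\<lambda>r. l r *\<^sub>R T r x)"
    have c1: "continuous_on {0..a} (\<lambda>s. integral {0..a} (\<lambda>v. (k s * lp (v - s)) *\<^sub>R T v x))"
      using integral_continuous_on_param[of "{0..a}" 0 a "\<lambda>s v. (k s * lp (v - s)) *\<^sub>R T v x"] cont2[of a]
      by (simp add: cbox_Pair_eq)
    have c2: "continuous_on {0..a} (\<lambda>s. k s *\<^sub>R T s ?W)"
      by (rule continuous_on_subset[OF weighted_orbit_continuous[OF k'(1)]]) auto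
    have "norm (integral {0..a} (\<lambda>s. integral {0..a} (\<lambda>v. (k s * lp (v - s)) *\<^sub>R T v x) - k s *\<^sub>R T s ?W))
        \<le> (N * exp (- \<nu> * a)) * (a - 0)"
    proof (rule integral_bound[OF a])
      show "continuous_on {0..a} (\<lambda>s. integral {0..a} (\<lambda>v. (k s * lp (v - s)) *\<^sub>R T v x) - k s *\<^sub>R T s ?W)"
        by (intro continuous_on_diff c1 c2)
      fix s assume s: "s \<in> {0..a}"
      have tail: "norm (?W - ?w s) \<le> C' * M * norm x / \<nu> * exp (- \<nu> * (a - s))"
        using exp_bounded_integral_halfline(3)[OF weighted_orbit_continuous[OF l'(1)] nu weighted_orbit_bound[OF lb], of "a - s"] s
        by (simp add: orbit_mean_def)
      have "integral {0..a} (\<lambda>v. (k s * lp (v - s)) *\<^sub>R T v x) - k s *\<^sub>R T s ?W = k s *\<^sub>R T s (?w s - ?W)"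
        using s by (simp add: inner T_diff scaleR_diff_right)
      also have "norm \<dots> \<le> (C * exp (- \<nu> * s)) * (M * (C' * M * norm x / \<nu> * exp (- \<nu> * (a - s))))"
        unfolding norm_scaleR
      proof (rule mult_mono)
        show "norm (T s (?w s - ?W)) \<le> M * (C' * M * norm x / \<nu> * exp (- \<nu> * (a - s)))"
          by (rule order_trans[OF bound mult_left_mono])
            (use s tail M_ge_1 in \<open>auto simp: norm_minus_commute\<close>)
      qed (use s kb k' in auto)
      also have "\<dots> = N * (exp (- \<nu> * s) * exp (- \<nu> * (a - s)))"
        by (simp add: N_def mult_ac)
      also have "exp (- \<nu> * s) * exp (- \<nu> * (a - s)) = exp (- \<nu> * a)"
        by (simp add: algebra_simps flip: exp_add)
      finally show "norm (integral {0..a} (\<lambda>v. (k s * lp (v - s)) *\<^sub>R T v x) - k s *\<^sub>R T s ?W) \<le> N * exp (- \<nu> * a)" .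
    qed
    moreover have "integral {0..a} (\<lambda>s. integral {0..a} (\<lambda>v. (k s * lp (v - s)) *\<^sub>R T v x) - k s *\<^sub>R T s ?W) =
        I a - integral {0..a} (\<lambda>s. k s *\<^sub>R T s ?W)"
      unfolding I_def by (intro integral_diff integrable_continuous_interval c1 c2)
    ultimately show ?thesis
      by simp
  qed
  have "((\<lambda>a. N * (a ^ 1 * exp (- \<nu> * a))) \<longlongrightarrow> 0) at_top"
    by (intro tendsto_mult_right_zero exp_kernel_tendsto_0[OF exp_kernel_power] nu)
  then have "((\<lambda>a. I a - integral {0..a} (\<lambda>s. k s *\<^sub>R T s ?W)) \<longlongrightarrow> 0) at_top"
    by (rule Lim_null_comparison[rotated], intro eventually_at_top_linorderI[of 0])
      (use diff in \<open>simp add: mult_ac\<close>)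
  from tendsto_add[OF this orbit_mean_integrable(2)[OF k, of ?W]]
  have "(I \<longlongrightarrow> orbit_mean k ?W) at_top"
    by simp
  moreover have "(I \<longlongrightarrow> orbit_mean q x) at_top"
    by (rule Lim_transform_eventually[OF orbit_mean_integrable(2)[OF q]])
      (use swap in \<open>auto intro!: eventually_at_top_linorderI[of 0]\<close>)
  ultimately show ?thesis
    using tendsto_unique trivial_limit_at_top_linorder by blast
qed

end

section \<open>Polynomial stability yields an invertible generator and a decay rate\<close>

text \<open>The weights \<open>s\<^sup>a e\<^bsup>-\<mu>s\<^esup>\<close> form a convolution semigroup up to Beta factors.\<close>

lemma gamma_kernel_convolution:
  fixes a b \<mu> v :: real and m :: nat
  assumes ab: "a > 0" "b > 0" "a + b + 1 = real m" and v: "v \<ge> 0"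
  shows "((\<lambda>s. (s powr a * exp (- \<mu> * s)) * ((v - s) powr b * exp (- \<mu> * (v - s)))) has_integral
    Beta (a + 1) (b + 1) * (v ^ m * exp (- \<mu> * v))) {0..v}"
proof (cases "v = 0")
  case True
  moreover have "m \<noteq> 0"
    using ab by (cases m) auto
  ultimately show ?thesis
    using has_integral_refl(2)[of _ "0::real"] by (simp add: zero_power)
next
  case False
  with v have v: "v > 0" by simp
  have "((\<lambda>t. t powr a * (1 - t) powr b) has_integral Beta (a + 1) (b + 1)) {0..1}"
    using has_integral_Beta_real[of "a + 1" "b + 1"] ab by simp
  then have "((\<lambda>s. ((1 / v) * s) powr a * (1 - (1 / v) * s) powr b) has_integral (v * Beta (a + 1) (b + 1)))
      ((\<lambda>x. x / (1 / v)) ` {0..1})"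
    using has_integral_stretch_real[of "\<lambda>t. t powr a * (1 - t) powr b" _ 0 1 "1 / v"] v by simp
  also have "(\<lambda>x. x / (1 / v)) ` {0..1} = {0..v}"
    using v image_mult_atLeastAtMost[of v 0 1] by (simp add: mult.commute)
  finally have int: "((\<lambda>s. (v powr a * v powr b * exp (- \<mu> * v)) * (((1 / v) * s) powr a * (1 - (1 / v) * s) powr b))
      has_integral (v powr a * v powr b * exp (- \<mu> * v)) * (v * Beta (a + 1) (b + 1))) {0..v}"
    by (rule has_integral_mult_right)
  have val: "(v powr a * v powr b * exp (- \<mu> * v)) * (v * Beta (a + 1) (b + 1)) =
      Beta (a + 1) (b + 1) * (v ^ m * exp (- \<mu> * v))"
  proof -
    have "v powr a * v powr b * v = v powr (a + b + 1)"
      using v by (simp add: powr_add)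
    then show ?thesis
      using v ab by (simp add: powr_realpow mult_ac)
  qed
  have eq: "(v powr a * v powr b * exp (- \<mu> * v)) * (((1 / v) * s) powr a * (1 - (1 / v) * s) powr b) =
      (s powr a * exp (- \<mu> * s)) * ((v - s) powr b * exp (- \<mu> * (v - s)))" if "s \<in> {0..v}" for s
  proof -
    have 1: "v powr a * ((1 / v) * s) powr a = s powr a"
      using v that by (subst powr_mult[symmetric]) auto
    have 2: "v powr b * (1 - (1 / v) * s) powr b = (v - s) powr b"
      using v that by (subst powr_mult[symmetric]) (auto simp: right_diff_distrib)
    have 3: "exp (- \<mu> * v) = exp (- \<mu> * s) * exp (- \<mu> * (v - s))"
      by (simp add: algebra_simps flip: exp_add)
    have "(v powr a * v powr b * exp (- \<mu> * v)) * (((1 / v) * s) powr a * (1 - (1 / v) * s) powr b) =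
        (v powr a * ((1 / v) * s) powr a) * (v powr b * (1 - (1 / v) * s) powr b) * exp (- \<mu> * v)"
      by (simp only: mult_ac)
    also have "\<dots> = s powr a * (v - s) powr b * (exp (- \<mu> * s) * exp (- \<mu> * (v - s)))"
      by (simp only: 1 2 flip: 3)
    finally show ?thesis
      by (simp only: mult_ac)
  qed
  show ?thesis
    by (rule has_integral_eq[OF eq int[unfolded val]])
qed

context bounded_C0_semigroup
begin

definition decays :: "('a \<Rightarrow> 'a) \<Rightarrow> bool" where
  "decays V \<longleftrightarrow> (\<exists>\<beta>>0. \<exists>N>0. \<forall>t>0. \<forall>x. norm (T t (V x)) \<le> N * t powr (- \<beta>) * norm x)"

lemma decays_compose:
  assumes "decays V" and W: "C \<ge> 0" "\<And>x. norm (W x) \<le> C * norm x"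
  shows "decays (\<lambda>x. V (W x))"
proof -
  obtain \<beta> N where *: "\<beta> > 0" "N > 0" "\<And>t x. t > 0 \<Longrightarrow> norm (T t (V x)) \<le> N * t powr (- \<beta>) * norm x"
    using assms(1) by (auto simp: decays_def)
  have "norm (T t (V (W x))) \<le> (N * (C + 1)) * t powr (- \<beta>) * norm x" if "t > 0" for t x
  proof -
    have "norm (T t (V (W x))) \<le> N * t powr (- \<beta>) * norm (W x)"
      by (rule *(3)[OF that])
    also have "\<dots> \<le> N * t powr (- \<beta>) * ((C + 1) * norm x)"
      using * W(2)[of x] by (intro mult_left_mono) (auto simp: distrib_right intro: order_trans)
    finally show ?thesis
      by (simp add: mult_ac)
  qed
  then show ?thesis
    unfolding decays_def using * W by (intro exI[of _ \<beta>] conjI exI[of _ "N * (C + 1)"]) auto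
qed

lemma decays_scale: 
  assumes "decays V"
  shows "decays (\<lambda>x. c *\<^sub>R V x)"
proof -
  obtain \<beta> N where *: "\<beta> > 0" "N > 0" "\<And>t x. t > 0 \<Longrightarrow> norm (T t (V x)) \<le> N * t powr (- \<beta>) * norm x"
    using assms by (auto simp: decays_def)
  have "norm (T t (c *\<^sub>R V x)) \<le> ((\<bar>c\<bar> + 1) * N) * t powr (- \<beta>) * norm x" if "t > 0" for t x
  proof -
    have "norm (T t (c *\<^sub>R V x)) = \<bar>c\<bar> * norm (T t (V x))"
      using that by (simp add: T_scaleR)
    also have "\<dots> \<le> (\<bar>c\<bar> + 1) * (N * t powr (- \<beta>) * norm x)"
      using *(3)[OF that] by (intro mult_mono) auto
    finally show ?thesis
      by (simp add: mult_ac)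
  qed
  then show ?thesis
    unfolding decays_def using * by (intro exI[of _ \<beta>] conjI exI[of _ "(\<bar>c\<bar> + 1) * N"]) auto
qed

text \<open>A fractional power precomposed with the resolvent is the next fractional power, whose weight
  is continuous at \<open>0\<close>.\<close>

lemma decays_gamma_kernel:
  assumes mu: "\<mu> > 0" and al: "\<alpha> > 0" and dec: "decays (neg_fractional_power T \<mu> \<alpha>)"
  shows "decays (orbit_mean (\<lambda>s. s powr \<alpha> * exp (- \<mu> * s)))"
proof -
  let ?k = "\<lambda>s. s powr \<alpha> * exp (- \<mu> * s)"
  let ?s = "\<lambda>s. s powr (\<alpha> - 1) * exp (- \<mu> * s)"
  have k: "exp_kernel ?k"
    by (rule exp_kernel_powr[OF al mu])
  interpret k: bounded_linear "orbit_mean ?k"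
    by (rule orbit_mean_linear[OF k])
  obtain C where C: "C \<ge> 0" "\<And>x. norm (resolvent \<mu> x) \<le> C * norm x"
    using orbit_mean_bound[OF exp_kernel_exp[OF mu]] unfolding resolvent_def by blast
  have eq: "orbit_mean ?k y = (\<alpha> * Gamma \<alpha>) *\<^sub>R neg_fractional_power T \<mu> \<alpha> (resolvent \<mu> y)" for y
  proof -
    let ?x = "resolvent \<mu> y"
    have x: "?x \<in> D" "\<mu> *\<^sub>R ?x - G ?x = y"
      using resolvent_in_D[OF mu, of y] by auto
    have "(?k has_real_derivative (\<alpha> * ?s s - \<mu> * ?k s)) (at s)" if "s > 0" for s
      using that
      by (auto intro!: derivative_eq_intros has_real_derivative_powr simp: algebra_simps powr_diff)
    from orbit_mean_by_parts[OF k this x(1)]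
    have "((\<lambda>s. (\<alpha> * ?s s - \<mu> * ?k s) *\<^sub>R T s ?x) has_integral (- orbit_mean ?k (G ?x))) {0..}"
      using al by simp
    moreover have "((\<lambda>s. \<mu> *\<^sub>R (?k s *\<^sub>R T s ?x)) has_integral \<mu> *\<^sub>R orbit_mean ?k ?x) {0..}"
      unfolding orbit_mean_def by (intro has_integral_cmul integrable_integral orbit_mean_integrable k)
    ultimately have "((\<lambda>s. (\<alpha> * ?s s - \<mu> * ?k s) *\<^sub>R T s ?x + \<mu> *\<^sub>R (?k s *\<^sub>R T s ?x)) has_integral
        (- orbit_mean ?k (G ?x) + \<mu> *\<^sub>R orbit_mean ?k ?x)) {0..}"
      by (rule has_integral_add)
    moreover have "- orbit_mean ?k (G ?x) + \<mu> *\<^sub>R orbit_mean ?k ?x = orbit_mean ?k (\<mu> *\<^sub>R ?x - G ?x)"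
      by (subst k.diff, subst k.scaleR) (simp only: diff_conv_add_uminus add.commute)
    moreover have "(\<alpha> * ?s s - \<mu> * ?k s) *\<^sub>R T s ?x + \<mu> *\<^sub>R (?k s *\<^sub>R T s ?x) = \<alpha> *\<^sub>R (?s s *\<^sub>R T s ?x)" for s
      by (simp add: algebra_simps)
    ultimately have "((\<lambda>s. \<alpha> *\<^sub>R (?s s *\<^sub>R T s ?x)) has_integral orbit_mean ?k y) {0..}"
      by (simp only: x(2))
    then have "((\<lambda>s. (1 / \<alpha>) *\<^sub>R (\<alpha> *\<^sub>R (?s s *\<^sub>R T s ?x))) has_integral (1 / \<alpha>) *\<^sub>R orbit_mean ?k y) {0..}"
      by (rule has_integral_cmul)
    then have "integral {0..} (\<lambda>s. ?s s *\<^sub>R T s ?x) = (1 / \<alpha>) *\<^sub>R orbit_mean ?k y"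
      using al by (simp add: has_integral_iff)
    then show ?thesis
      unfolding neg_fractional_power_def using al less_imp_neq[OF Gamma_real_pos[OF al]] by simp
  qed
  show ?thesis
    unfolding eq by (intro decays_scale decays_compose[OF dec C])
qed

text \<open>Composing with a complementary fractional power turns the real exponent into an integer one,
  from which one can step down to the resolvent.\<close>

lemma decays_power_kernel:
  assumes mu: "\<mu> > 0" and al: "\<alpha> > 0" and dec: "decays (orbit_mean (\<lambda>s. s powr \<alpha> * exp (- \<mu> * s)))"
  shows "\<exists>m. decays (orbit_mean (\<lambda>s. s ^ m * exp (- \<mu> * s)))"
proof -
  define m where "m = nat \<lceil>\<alpha>\<rceil> + 2"
  define b where "b = real m - 1 - \<alpha>"
  have b: "b > 0" "\<alpha> + b + 1 = real m"
    unfolding b_def m_def using al by (auto, linarith)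
  let ?c = "Beta (\<alpha> + 1) (b + 1)"
  let ?k = "\<lambda>s. s powr \<alpha> * exp (- \<mu> * s)" and ?l = "\<lambda>s. s powr b * exp (- \<mu> * s)"
    and ?E = "\<lambda>s. s ^ m * exp (- \<mu> * s)"
  have c: "?c > 0"
    using al b unfolding Beta_def by (simp add: Gamma_real_pos)
  have l: "exp_kernel ?l"
    by (rule exp_kernel_powr[OF b(1) mu])
  obtain C where C: "C \<ge> 0" "\<And>x. norm (orbit_mean ?l x) \<le> C * norm x"
    using orbit_mean_bound[OF l] by blast
  have "orbit_mean ?k (orbit_mean ?l x) = orbit_mean (\<lambda>s. ?c * ?E s) x" for x
    by (rule orbit_mean_convolution[OF exp_kernel_powr[OF al mu] l _ exp_kernel_scale[OF exp_kernel_power[OF mu]]])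
      (use gamma_kernel_convolution[OF al b] in auto)
  then have "orbit_mean ?E x = (1 / ?c) *\<^sub>R orbit_mean ?k (orbit_mean ?l x)" for x
    unfolding orbit_mean_kernel_scale using c by simp
  then have "orbit_mean ?E = (\<lambda>x. (1 / ?c) *\<^sub>R orbit_mean ?k (orbit_mean ?l x))"
    by blast
  moreover have "decays (\<lambda>x. (1 / ?c) *\<^sub>R orbit_mean ?k (orbit_mean ?l x))"
    by (intro decays_scale decays_compose[OF dec C])
  ultimately show ?thesis
    by metis
qed

text \<open>A Landau-type inequality, with \<open>w\<close> replaced by its average over \<open>[0, h]\<close>: the average is
  controlled by \<open>v\<close> because \<open>G v\<close> integrates to a difference, and the error by \<open>G w\<close>.\<close>

lemma interpolation:
  assumes v: "v \<in> D" and w: "w \<in> D" and eq: "c *\<^sub>R w = \<mu> *\<^sub>R v - G v"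
    and c: "c \<ge> 1" and mu: "\<mu> > 0" and h: "0 < h" "h \<le> 1"
  shows "norm w \<le> h * M * norm (G w) + (\<mu> * M + M + 1) / h * norm v"
proof -
  have cont: "continuous_on {0..h} (\<lambda>r. T r z)" for z
    by (rule continuous_on_subset[OF orbit_continuous]) auto
  let ?I = "\<lambda>z. integral {0..h} (\<lambda>r. T r z)"
  have "c *\<^sub>R ?I w = integral {0..h} (\<lambda>r. \<mu> *\<^sub>R T r v - T r (G v))"
    by (subst integral_cmul[symmetric], rule integral_cong) (use eq in \<open>auto simp flip: T_scaleR T_diff\<close>)
  also have "\<dots> = \<mu> *\<^sub>R ?I v - (T h v - v)"
    using orbit_integral[OF v, of h] h
    by (subst integral_diff) (auto intro!: integrable_continuous_interval continuous_intros cont simp: has_integral_iff)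
  finally have cI: "c *\<^sub>R ?I w = \<mu> *\<^sub>R ?I v - (T h v - v)" .
  have "norm (?I v) \<le> (M * norm v) * (h - 0)"
    by (rule integral_bound) (use h cont bound in auto)
  also have "\<dots> \<le> (M * norm v) * 1"
    using h M_ge_1 by (intro mult_left_mono) auto
  finally have Iv: "norm (\<mu> *\<^sub>R ?I v) \<le> \<mu> * (M * norm v)"
    using mu by simp
  have Tv: "norm (T h v - v) \<le> M * norm v + norm v"
    using norm_triangle_ineq4[of "T h v" v] bound[of h v] h by simp
  have "norm (?I w) \<le> c * norm (?I w)"
    using c mult_right_mono[of 1 c "norm (?I w)"] by simp
  also have "\<dots> = norm (c *\<^sub>R ?I w)"
    using c by simp
  also have "\<dots> \<le> (\<mu> * M + M + 1) * norm v"
    unfolding cI using norm_triangle_ineq4[of "\<mu> *\<^sub>R ?I v" "T h v - v"] Iv Tv by (simp add: algebra_simps)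
  finally have Iw: "norm (?I w) \<le> (\<mu> * M + M + 1) * norm v" .
  have "norm (integral {0..h} (\<lambda>r. T r w - w)) \<le> (h * M * norm (G w)) * (h - 0)"
  proof (rule integral_bound)
    fix t assume t: "t \<in> {0..h}"
    have "norm (T t w - w) \<le> t * M * norm (G w)"
      using orbit_lipschitz[OF w] t by simp
    also have "\<dots> \<le> h * M * norm (G w)"
      using t M_ge_1 by (intro mult_right_mono) auto
    finally show "norm (T t w - w) \<le> h * M * norm (G w)" .
  qed (use h in \<open>auto intro!: continuous_intros cont\<close>)
  moreover have "integral {0..h} (\<lambda>r. T r w - w) = ?I w - h *\<^sub>R w"
    using h by (subst integral_diff) (auto intro!: integrable_continuous_interval cont)
  ultimately have "norm (h *\<^sub>R w) \<le> h * (h * M * norm (G w)) + (\<mu> * M + M + 1) * norm v"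
    using Iw norm_triangle_sub[of "h *\<^sub>R w" "?I w"] by (simp add: norm_minus_commute algebra_simps)
  then show ?thesis
    using h by (simp add: field_simps)
qed

text \<open>With \<open>v\<close> and \<open>w\<close> the orbits of the two means, \<open>v\<close> decays like \<open>t\<^bsup>-\<beta>\<^esup>\<close> while \<open>G w\<close> stays
  bounded; for \<open>t \<ge> 1\<close>, interpolation with \<open>h = t\<^bsup>-\<beta>/2\<^esup>\<close> balances both terms at half the rate.\<close>

lemma decays_power_kernel_descend:
  assumes mu: "\<mu> > 0" and dec: "decays (orbit_mean (\<lambda>s. s ^ Suc m * exp (- \<mu> * s)))"
  shows "decays (orbit_mean (\<lambda>s. s ^ m * exp (- \<mu> * s)))"
proof -
  let ?E = "\<lambda>m s. s ^ m * exp (- \<mu> * s)"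
  let ?E' = "\<lambda>m s. real m * ?E (m - 1) s + (- \<mu>) * ?E m s"
  have E: "exp_kernel (?E m)" for m
    by (rule exp_kernel_power[OF mu])
  have E': "exp_kernel (?E' m)" for m
    by (intro exp_kernel_add exp_kernel_scale E)
  have deriv: "(?E m has_real_derivative ?E' m s) (at s)" for m s
    by (auto intro!: derivative_eq_intros simp: algebra_simps)
  have gen: "orbit_mean (?E m) x \<in> D \<and> G (orbit_mean (?E m) x) = - ?E m 0 *\<^sub>R x - orbit_mean (?E' m) x"
    for m x
    by (rule orbit_mean_generator[OF E E' deriv])
  obtain \<beta> N where N: "\<beta> > 0" "N > 0"
      "\<And>t x. t > 0 \<Longrightarrow> norm (T t (orbit_mean (?E (Suc m)) x)) \<le> N * t powr (- \<beta>) * norm x"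
    using dec unfolding decays_def by blast
  obtain C0 where C0: "C0 \<ge> 0" "\<And>x. norm (orbit_mean (?E m) x) \<le> C0 * norm x"
    using orbit_mean_bound[OF E] by blast
  obtain C1 where C1: "C1 \<ge> 0" "\<And>x. norm (orbit_mean (?E' m) x) \<le> C1 * norm x"
    using orbit_mean_bound[OF E'] by blast
  define B where "B = \<mu> * M + M + 1"
  define N' where "N' = M * (M * (1 + C1)) + B * N + M * C0"
  have B: "B > 0"
    using mu M_ge_1 by (simp add: B_def add_pos_pos)
  have "norm (T t (orbit_mean (?E m) x)) \<le> N' * t powr (- (\<beta> / 2)) * norm x" if t: "t > 0" for t x
  proof -
    let ?w = "T t (orbit_mean (?E m) x)" and ?v = "T t (orbit_mean (?E (Suc m)) x)"
    have w: "?w \<in> D" and v: "?v \<in> D"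
      using gen D_T t by (blast intro: less_imp_le)+
    have le1: "norm ?w \<le> M * C0 * norm x"
      using order_trans[OF bound mult_left_mono[OF C0(2)]] t M_ge_1 by (simp add: mult.assoc)
    show ?thesis
    proof (cases "t \<ge> 1")
      case False
      have "1 \<le> t powr (- (\<beta> / 2))"
        using False t N by (simp add: powr_minus inverse_eq_divide powr_le1)
      then have "M * C0 * norm x \<le> (M * C0 * norm x) * t powr (- (\<beta> / 2))"
        using C0 M_ge_1 mult_left_mono[of 1 "t powr (- (\<beta> / 2))" "M * C0 * norm x"] by simp
      also have "\<dots> \<le> (N' * norm x) * t powr (- (\<beta> / 2))"
        using C1 N M_ge_1 B unfolding N'_def by (intro mult_right_mono) auto
      finally show ?thesis
        using le1 by (simp add: mult_ac)
    next
      case True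
      define h where "h = t powr (- (\<beta> / 2))"
      have h: "0 < h" "h \<le> 1"
        using True t N by (auto simp: h_def powr_minus inverse_eq_divide ge_one_powr_ge_zero)
      have Gw: "norm (G ?w) \<le> M * (1 + C1) * norm x"
      proof -
        have "norm (G (orbit_mean (?E m) x)) \<le> norm ((- ?E m 0) *\<^sub>R x) + norm (orbit_mean (?E' m) x)"
          unfolding conjunct2[OF gen] by (rule norm_triangle_ineq4)
        also have "\<dots> \<le> 1 * norm x + C1 * norm x"
          using C1 by (intro add_mono) (auto simp: power_0_left)
        finally have "norm (G (orbit_mean (?E m) x)) \<le> (1 + C1) * norm x"
          by (simp add: algebra_simps)
        then have "M * norm (G (orbit_mean (?E m) x)) \<le> M * ((1 + C1) * norm x)"
          using M_ge_1 by (intro mult_left_mono) auto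
        moreover have "norm (G ?w) \<le> M * norm (G (orbit_mean (?E m) x))"
          using D_T[of "orbit_mean (?E m) x" t] gen[of m x] t by (simp add: bound)
        ultimately show ?thesis
          by (simp add: mult.assoc)
      qed
      have eq: "real (Suc m) *\<^sub>R ?w = \<mu> *\<^sub>R ?v - G ?v"
      proof -
        have "orbit_mean (?E' (Suc m)) x = real (Suc m) *\<^sub>R orbit_mean (?E m) x + (- \<mu>) *\<^sub>R orbit_mean (?E (Suc m)) x"
          using orbit_mean_kernel_add[OF exp_kernel_scale[OF E] exp_kernel_scale[OF E], of "real (Suc m)" "Suc m - 1" "- \<mu>" "Suc m" x]
          by (simp only: orbit_mean_kernel_scale diff_Suc_1)
        then have "G (orbit_mean (?E (Suc m)) x) = \<mu> *\<^sub>R orbit_mean (?E (Suc m)) x - real (Suc m) *\<^sub>R orbit_mean (?E m) x"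
          using gen[of "Suc m" x] by simp
        then have "G ?v = \<mu> *\<^sub>R ?v - real (Suc m) *\<^sub>R ?w"
          using D_T[of "orbit_mean (?E (Suc m)) x" t] gen[of "Suc m" x] t by (simp add: T_diff T_scaleR)
        then show ?thesis by simp
      qed
      have "norm ?w \<le> h * M * norm (G ?w) + B / h * norm ?v"
        unfolding B_def by (rule interpolation[OF v w eq _ mu h]) simp
      also have "\<dots> \<le> h * M * (M * (1 + C1) * norm x) + B / h * (N * t powr (- \<beta>) * norm x)"
        using h M_ge_1 B by (intro add_mono mult_left_mono Gw N(3)[OF t]) auto
      also have "t powr (- \<beta>) = h * h"
        unfolding h_def by (simp flip: powr_add)
      also have "h * M * (M * (1 + C1) * norm x) + B / h * (N * (h * h) * norm x) = (M * (M * (1 + C1)) + B * N) * h * norm x"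
        using h by (simp add: field_simps)
      also have "\<dots> \<le> N' * h * norm x"
        using h C0 M_ge_1 unfolding N'_def by (intro mult_right_mono) auto
      finally show ?thesis
        by (simp add: h_def)
    qed
  qed
  moreover have "N' > 0"
    unfolding N'_def using B N C0 C1 M_ge_1 by (intro add_pos_nonneg add_nonneg_pos) auto
  ultimately show ?thesis
    unfolding decays_def using N by (intro exI[of _ "\<beta> / 2"] conjI exI[of _ N']) auto
qed

lemma decays_resolvent:
  assumes "\<mu> > 0" "decays (orbit_mean (\<lambda>s. s ^ m * exp (- \<mu> * s)))"
  shows "decays (resolvent \<mu>)"
  using assms(2)
proof (induction m)
  case 0
  then show ?case by (simp add: resolvent_def)
next
  case (Suc m)
  show ?case
    by (rule Suc.IH[OF decays_power_kernel_descend[OF assms(1) Suc.prems]])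
qed

lemma polynomially_stable_imp_decays_resolvent:
  assumes "polynomially_stable T"
  shows "\<exists>\<mu>>0. decays (resolvent \<mu>)"
proof -
  obtain \<mu> M' \<epsilon> \<alpha> \<beta> N where *: "M' > 0" "\<epsilon> > 0"
      "\<forall>t\<ge>0. \<forall>x. norm (T t x) \<le> M' * exp ((\<mu> - \<epsilon>) * t) * norm x" "\<alpha> > 0" "\<beta> > 0" "N > 0"
      "\<forall>t>0. \<forall>x. norm (T t (neg_fractional_power T \<mu> \<alpha> x)) \<le> N * t powr (- \<beta>) * norm x"
    using assms unfolding polynomially_stable_def by (elim exE conjE) (rule that)
  show ?thesis
  proof (cases "\<mu> > 0")
    case True
    have "decays (neg_fractional_power T \<mu> \<alpha>)"
      unfolding decays_def using * by blast
    then show ?thesis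
      using decays_gamma_kernel decays_power_kernel decays_resolvent True *(4) by blast
  next
    case False
    \<comment> \<open>The growth bound is negative, so the semigroup is even exponentially stable.\<close>
    obtain C where C: "C \<ge> 0" "\<And>x. norm (resolvent 1 x) \<le> C * norm x"
      using orbit_mean_bound[OF exp_kernel_exp[of 1]] unfolding resolvent_def by auto
    have "norm (T t x) \<le> (M' / \<epsilon>) * t powr (- 1) * norm x" if t: "t > 0" for t x
    proof -
      have "exp ((\<mu> - \<epsilon>) * t) \<le> exp (- (\<epsilon> * t))"
        using False t by (simp add: left_diff_distrib mult_nonpos_nonneg)
      also have "\<dots> \<le> 1 / (\<epsilon> * t)"
        using exp_ge_add_one_self[of "\<epsilon> * t"] t *(2)
        by (simp add: exp_minus inverse_eq_divide frac_le del: exp_ge_add_one_self)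
      finally have "M' * exp ((\<mu> - \<epsilon>) * t) * norm x \<le> M' * (1 / (\<epsilon> * t)) * norm x"
        using * by (intro mult_right_mono mult_left_mono) auto
      then show ?thesis
        using *(3)[rule_format, of t x] t by (simp add: powr_minus_divide)
    qed
    then have "decays (\<lambda>x. x)"
      unfolding decays_def using * by (intro exI[of _ 1] conjI exI[of _ "M' / \<epsilon>"]) auto
    then have "decays (resolvent 1)"
      using decays_compose[of "\<lambda>x. x", OF _ C] by simp
    then show ?thesis
      by (intro exI[of _ 1]) simp
  qed
qed

text \<open>Decay of \<open>T t\<close> on the range of the resolvent \<open>R\<close> keeps \<open>0\<close> out of the approximate point
  spectrum: a vector almost annihilated by \<open>G\<close> hardly moves along its orbit, although
  \<open>x = R (\<mu> x - G x)\<close> forces that orbit to lose half its norm by a fixed time, up to a multiple of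
  \<open>norm (G x)\<close>.\<close>

lemma decays_resolvent_lower_bound:
  assumes mu: "\<mu> > 0" and dec: "decays (resolvent \<mu>)"
  obtains c where "c > 0" "\<And>x. x \<in> D \<Longrightarrow> c * norm x \<le> norm (G x)"
proof -
  obtain \<beta> N where N: "\<beta> > 0" "N > 0"
      "\<And>t x. t > 0 \<Longrightarrow> norm (T t (resolvent \<mu> x)) \<le> N * t powr (- \<beta>) * norm x"
    using dec unfolding decays_def by blast
  \<comment> \<open>The time at which the decay factor \<open>N t\<^bsup>-\<beta>\<^esup> \<mu>\<close> has dropped to \<open>1/2\<close>.\<close>
  define t where "t = (2 * N * \<mu>) powr (1 / \<beta>)"
  have t: "t > 0"
    using N mu by (simp add: t_def)
  have tb: "t powr (- \<beta>) = 1 / (2 * N * \<mu>)"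
    using N mu by (simp add: t_def powr_powr powr_minus_divide)
  define c where "c = 1 / (2 * (1 / (2 * \<mu>) + t * M))"
  have pos: "1 / (2 * \<mu>) + t * M > 0"
    using t mu M_ge_1 by (intro add_pos_pos) auto
  have "c * norm x \<le> norm (G x)" if x: "x \<in> D" for x
  proof -
    have "norm (T t x) = norm (T t (resolvent \<mu> (\<mu> *\<^sub>R x - G x)))"
      by (simp add: resolvent_left_inverse[OF mu x])
    also have "\<dots> \<le> N * t powr (- \<beta>) * norm (\<mu> *\<^sub>R x - G x)"
      by (rule N(3)[OF t])
    also have "\<dots> \<le> (1 / (2 * \<mu>)) * (\<mu> * norm x + norm (G x))"
      unfolding tb using N mu norm_triangle_ineq4[of "\<mu> *\<^sub>R x" "G x"] by (simp add: divide_right_mono)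
    finally have "norm (T t x) \<le> norm x / 2 + norm (G x) / (2 * \<mu>)"
      using mu by (simp add: field_simps)
    moreover have "norm x \<le> norm (T t x) + t * M * norm (G x)"
      using norm_triangle_sub[of x "T t x"] orbit_lipschitz[OF x, of t] t by (simp add: norm_minus_commute)
    ultimately have "norm x \<le> 2 * (1 / (2 * \<mu>) + t * M) * norm (G x)"
      by (simp add: algebra_simps)
    then show ?thesis
      unfolding c_def using pos by (simp add: pos_divide_le_eq mult.commute)
  qed
  then show ?thesis
    using that[of c] pos by (simp add: c_def)
qed

text \<open>Bounded below, \<open>G\<close> is invertible: the resolvents at \<open>1 / (n + 1)\<close> applied to \<open>-x\<close> form
  a Cauchy sequence, and closedness identifies its limit as a preimage of \<open>x\<close>.\<close>

lemma bounded_below_imp_bounded_inverse: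
  assumes c: "c > 0" "\<And>x. x \<in> D \<Longrightarrow> c * norm x \<le> norm (G x)"
  obtains R where "bounded_inverse D G R"
proof -
  have le: "norm x \<le> norm (G x) / c" if "x \<in> D" for x
    using c(2)[OF that] c(1) by (simp add: field_simps)
  have surj: "\<exists>y\<in>D. G y = x" for x
  proof -
    define \<kappa> where "\<kappa> n = inverse (real (Suc n))" for n
    define y where "y n = resolvent (\<kappa> n) (- x)" for n
    have lam: "\<kappa> n > 0" for n
      by (simp add: \<kappa>_def)
    have lim: "\<kappa> \<longlonglongrightarrow> 0"
      unfolding \<kappa>_def by (rule LIMSEQ_inverse_real_of_nat)
    have y: "y n \<in> D" "G (y n) = \<kappa> n *\<^sub>R y n + x" for n
      using resolvent_in_D[OF lam, of n "- x"] by (auto simp: y_def)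
    obtain n0 where n0: "\<And>n. n \<ge> n0 \<Longrightarrow> \<kappa> n < c / 2"
      using order_tendstoD(2)[OF lim, of "c/2"] c by (auto simp: eventually_sequentially)
    define K where "K = 2 * norm x / c"
    have yb: "norm (y n) \<le> K" if "n \<ge> n0" for n
    proof -
      have "c * norm (y n) \<le> norm (\<kappa> n *\<^sub>R y n + x)"
        using c(2)[OF y(1)] y(2) by metis
      also have "\<dots> \<le> \<kappa> n * norm (y n) + norm x"
        using norm_triangle_ineq[of "\<kappa> n *\<^sub>R y n" x] lam[of n] by simp
      also have "\<dots> \<le> c / 2 * norm (y n) + norm x"
        using n0[OF that] by (intro add_right_mono mult_right_mono) auto
      finally show ?thesis
        unfolding K_def using c by (simp add: field_simps)
    qed
    have "Cauchy y"
    proof (rule metric_CauchyI)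
      fix e :: real assume e: "e > 0"
      have "(\<lambda>n. \<kappa> n * K) \<longlonglongrightarrow> 0"
        by (rule tendsto_mult_left_zero[OF lim])
      then obtain n1 where n1: "\<And>n. n \<ge> n1 \<Longrightarrow> \<kappa> n * K < e * c / 2"
        using order_tendstoD(2)[of "\<lambda>n. \<kappa> n * K" 0 sequentially "e * c / 2"] c e by (auto simp: eventually_sequentially)
      have "dist (y m) (y n) < e" if "m \<ge> max n0 n1" "n \<ge> max n0 n1" for m n
      proof -
        have small: "norm (\<kappa> n *\<^sub>R y n) < e * c / 2" if "n \<ge> max n0 n1" for n
        proof -
          have "\<kappa> n * norm (y n) \<le> \<kappa> n * K"
            using that less_imp_le[OF lam[of n]] by (intro mult_left_mono yb) auto
          also have "\<dots> < e * c / 2"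
            using that by (intro n1) auto
          finally show ?thesis
            using lam[of n] by simp
        qed
        have d: "y m - y n \<in> D" "G (y m - y n) = \<kappa> m *\<^sub>R y m - \<kappa> n *\<^sub>R y n"
          using D_diff[OF y(1) y(1), of m n] by (auto simp: y(2))
        have "norm (y m - y n) \<le> norm (\<kappa> m *\<^sub>R y m - \<kappa> n *\<^sub>R y n) / c"
          using le[OF d(1)] d(2) by simp
        also have "\<dots> < (e * c / 2 + e * c / 2) / c"
          by (intro divide_strict_right_mono le_less_trans[OF norm_triangle_ineq4] add_strict_mono
              small that c)
        finally show ?thesis
          using c by (simp add: dist_norm)
      qed
      then show "\<exists>N. \<forall>m\<ge>N. \<forall>n\<ge>N. dist (y m) (y n) < e"
        by blast
    qed
    then obtain z where z: "y \<longlonglongrightarrow> z"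
      using convergent_eq_Cauchy by blast
    have "(\<lambda>n. \<kappa> n *\<^sub>R y n + x) \<longlonglongrightarrow> 0 *\<^sub>R z + x"
      by (intro tendsto_intros lim z)
    then have "(\<lambda>n. G (y n)) \<longlonglongrightarrow> x"
      by (simp add: y(2))
    from generator_closed[OF y(1) z this] show ?thesis
      by blast
  qed
  then obtain R where R: "\<And>x. R x \<in> D" "\<And>x. G (R x) = x"
    by metis
  have inj: "x = y" if "x \<in> D" "y \<in> D" "G x = G y" for x y
    using c(2)[of "x - y"] D_diff[OF that(1,2)] that(3) c(1) by (simp add: mult_le_0_iff)
  have "bounded_linear R"
  proof (rule bounded_linear_intro[where K = "1 / c"])
    show "R (x + y) = R x + R y" for x y
      by (rule inj) (use R D_add in auto)
    show "R (r *\<^sub>R x) = r *\<^sub>R R x" for r x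
      by (rule inj) (use R D_scaleR in auto)
    show "norm (R x) \<le> norm x * (1 / c)" for x
      using le[OF R(1), of x] by (simp add: R(2))
  qed
  moreover have "R (a *\<^sub>C x) = a *\<^sub>C R x" for a x
    by (rule inj) (use R D_scaleC in auto)
  moreover have "R (G x) = x" if "x \<in> D" for x
    by (rule inj) (use R that in auto)
  ultimately have "bounded_inverse D G R"
    unfolding bounded_inverse_def bounded_clinear_def using R by auto
  then show ?thesis
    by (rule that)
qed

text \<open>The rate passes from the resolvent to \<open>G\<^sup>-\<^sup>1\<close> because \<open>G\<^sup>-\<^sup>1 x = R (\<mu> G\<^sup>-\<^sup>1 x - x)\<close>.\<close>

theorem polynomially_stable_imp_decay_exponent:
  assumes "polynomially_stable T"
  shows "\<exists>\<alpha>. decay_exponent D G T \<alpha>"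
proof -
  obtain \<mu> where mu: "\<mu> > 0" and dec: "decays (resolvent \<mu>)"
    using polynomially_stable_imp_decays_resolvent[OF assms] by blast
  obtain c where "c > 0" "\<And>x. x \<in> D \<Longrightarrow> c * norm x \<le> norm (G x)"
    using decays_resolvent_lower_bound[OF mu dec] by blast
  then obtain R where R: "bounded_inverse D G R"
    using bounded_below_imp_bounded_inverse by blast
  then have lin: "bounded_linear R" and GR: "\<And>x. R x \<in> D" "\<And>x. G (R x) = x"
    by (auto simp: bounded_inverse_def bounded_clinearD)
  obtain B where B: "B > 0" "\<And>x. norm (R x) \<le> norm x * B"
    using bounded_linear.pos_bounded[OF lin] by blast
  have "decays (\<lambda>x. resolvent \<mu> (\<mu> *\<^sub>R R x - x))"
  proof (rule decays_compose[OF dec, where C = "\<mu> * B + 1"])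
    show "norm (\<mu> *\<^sub>R R x - x) \<le> (\<mu> * B + 1) * norm x" for x
    proof -
      have "norm (\<mu> *\<^sub>R R x - x) \<le> \<mu> * norm (R x) + norm x"
        using norm_triangle_ineq4[of "\<mu> *\<^sub>R R x" x] mu by simp
      also have "\<dots> \<le> \<mu> * (norm x * B) + norm x"
        using mu B(2) by (intro add_right_mono mult_left_mono) auto
      finally show ?thesis
        by (simp add: algebra_simps)
    qed
  qed (use mu B in simp)
  moreover have "resolvent \<mu> (\<mu> *\<^sub>R R x - x) = R x" for x
    using resolvent_left_inverse[OF mu GR(1)[of x]] GR(2)[of x] by simp
  ultimately obtain \<beta> N where "\<beta> > 0" "N > 0" "\<And>t x. t > 0 \<Longrightarrow> norm (T t (R x)) \<le> N * t powr (- \<beta>) * norm x"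
    by (auto simp: decays_def)
  then have "decay_exponent D G T (1 / \<beta>)"
    unfolding decay_exponent_def using R by (auto intro!: exI[of _ R] exI[of _ N])
  then show ?thesis
    by blast
qed

end

section \<open>The exosystem and the Sylvester equation\<close>

lemma bounded_semigroup_locale:
  assumes "generates_semigroup D G T" "bounded_semigroup T"
  obtains M where "bounded_C0_semigroup T D G M"
proof -
  obtain M where M: "\<And>t x. t \<ge> 0 \<Longrightarrow> norm (T t x) \<le> M * norm x"
    using assms(2) by (auto simp: bounded_semigroup_def)
  have "bounded_C0_semigroup T D G (max 1 M)"
  proof
    show "norm (T t x) \<le> max 1 M * norm x" if "t \<ge> 0" for t x
      using M[OF that, of x] mult_right_mono[of M "max 1 M" "norm x"] by simp
  qed (use assms in auto)
  then show ?thesis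
    by (rule that)
qed

context bounded_C0_semigroup
begin

lemma continuous_on_T:
  assumes f: "continuous_on X f" and g: "continuous_on X g" "\<And>s. s \<in> X \<Longrightarrow> g s \<ge> 0"
  shows "continuous_on X (\<lambda>s. T (g s) (f s))"
  unfolding continuous_on_def
proof
  fix s assume s: "s \<in> X"
  have Tg: "continuous_on X (\<lambda>r. T (g r) (f s))"
    using g by (intro continuous_on_compose2[OF orbit_continuous]) auto
  have "((\<lambda>r. T (g r) (f r - f s)) \<longlongrightarrow> 0) (at s within X)"
  proof (rule Lim_null_comparison)
    show "\<forall>\<^sub>F r in at s within X. norm (T (g r) (f r - f s)) \<le> M * norm (f r - f s)"
      using g by (auto simp: eventually_at_filter bound)
    have "(f \<longlongrightarrow> f s) (at s within X)"
      using f s by (simp add: continuous_on_def)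
    then show "((\<lambda>r. M * norm (f r - f s)) \<longlongrightarrow> 0) (at s within X)"
      by (intro tendsto_mult_right_zero) (simp add: tendsto_norm_zero_iff LIM_zero_iff)
  qed
  moreover have "((\<lambda>r. T (g r) (f s)) \<longlongrightarrow> T (g s) (f s)) (at s within X)"
    using Tg s by (simp add: continuous_on_def)
  ultimately have "((\<lambda>r. T (g r) (f r - f s) + T (g r) (f s)) \<longlongrightarrow> 0 + T (g s) (f s)) (at s within X)"
    by (rule tendsto_add)
  moreover have "\<forall>\<^sub>F r in at s within X. T (g r) (f r - f s) + T (g r) (f s) = T (g r) (f r)"
    using g by (auto simp: eventually_at_filter T_diff)
  ultimately show "((\<lambda>s. T (g s) (f s)) \<longlongrightarrow> T (g s) (f s)) (at s within X)"
    by (simp add: Lim_transform_eventually)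
qed

lemma orbit_backward_derivative:
  assumes x: "x \<in> D" and s: "s \<in> {0..t}"
  shows "((\<lambda>r. T (t - r) x) has_vector_derivative - T (t - s) (G x)) (at s within {0..t})"
proof -
  have "((\<lambda>r. t - r) has_vector_derivative -1) (at s within {0..t})"
    by (auto intro!: derivative_eq_intros simp flip: has_real_derivative_iff_has_vector_derivative)
  moreover have "((\<lambda>r. T r x) has_vector_derivative T (t - s) (G x)) (at (t - s) within (\<lambda>r. t - r) ` {0..t})"
    using s by (intro orbit_derivative[OF x]) auto
  ultimately have "((\<lambda>r. T r x) \<circ> (\<lambda>r. t - r) has_vector_derivative -1 *\<^sub>R T (t - s) (G x)) (at s within {0..t})"
    by (rule vector_diff_chain_within)
  then show ?thesis
    by (simp add: o_def)
qed

lemma decay_exponent_on_domain: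
  assumes "decay_exponent D G T \<alpha>"
  obtains N where "\<alpha> > 0" "N > 0"
    "\<And>t x. t > 0 \<Longrightarrow> x \<in> D \<Longrightarrow> norm (T t x) \<le> N * t powr (- 1 / \<alpha>) * norm (G x)"
proof -
  obtain R N where R: "bounded_inverse D G R" and N: "\<alpha> > 0" "N > 0"
    "\<And>t x. t > 0 \<Longrightarrow> norm (T t (R x)) \<le> N * t powr (- 1 / \<alpha>) * norm x"
    using assms by (auto simp: decay_exponent_def)
  have "norm (T t x) \<le> N * t powr (- 1 / \<alpha>) * norm (G x)" if "t > 0" "x \<in> D" for t x
    using N(3)[of t "G x"] R that by (simp add: bounded_inverse_def)
  then show ?thesis
    using that N by blast
qed

lemma powr_neg_tendsto_0: "\<alpha> > 0 \<Longrightarrow> ((\<lambda>t. c * t powr (- 1 / \<alpha>) * d) \<longlongrightarrow> 0) at_top"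
  for \<alpha> c d :: real
  by (intro tendsto_mult_left_zero tendsto_mult_right_zero tendsto_neg_powr filterlim_ident) auto

lemma strongly_stable:
  assumes "decay_exponent D G T \<alpha>"
  shows "((\<lambda>t. T t x) \<longlongrightarrow> 0) at_top"
proof (rule tendstoI)
  fix e :: real assume e: "e > 0"
  obtain N where al: "\<alpha> > 0" and N: "N > 0"
      "\<And>t x. t > 0 \<Longrightarrow> x \<in> D \<Longrightarrow> norm (T t x) \<le> N * t powr (- 1 / \<alpha>) * norm (G x)"
    using decay_exponent_on_domain[OF assms] by blast
  have "e / (2 * M) > 0"
    using e M_ge_1 by simp
  then obtain y where y: "y \<in> D" "dist y x < e / (2 * M)"
    using D_dense closure_approachable[of x D] by blast
  have "\<forall>\<^sub>F t in at_top. N * t powr (- 1 / \<alpha>) * norm (G y) < e / 2"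
    by (rule order_tendstoD(2)[OF powr_neg_tendsto_0[OF al]]) (use e in simp)
  then show "\<forall>\<^sub>F t in at_top. dist (T t x) 0 < e"
    using eventually_gt_at_top[of 0]
  proof eventually_elim
    fix t :: real assume t: "N * t powr (- 1 / \<alpha>) * norm (G y) < e / 2" "0 < t"
    have "norm (T t (x - y)) \<le> M * norm (x - y)"
      using t by (simp add: bound)
    also have "\<dots> < e / 2"
      using y(2) M_ge_1 by (simp add: dist_norm norm_minus_commute field_simps)
    finally have "norm (T t x - T t y) < e / 2"
      using t by (simp add: T_diff)
    moreover have "norm (T t y) < e / 2"
      using N(2)[OF t(2) y(1)] t(1) by simp
    ultimately show "dist (T t x) 0 < e"
      using norm_triangle_sub[of "T t x" "T t y"] by simp
  qed
qed

end

locale isometric_group =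
  fixes TS :: "real \<Rightarrow> 'w::complex_banach \<Rightarrow> 'w" and DS :: "'w set" and S :: "'w \<Rightarrow> 'w"
  assumes generates: "generates_group DS S TS" and isometric: "isometric TS"
begin

lemma group_blin: "bounded_linear (TS t)"
  and group_0: "TS 0 x = x"
  and group_add: "TS (s + t) x = TS s (TS t x)"
  and group_at_0: "((\<lambda>t. TS t x) \<longlongrightarrow> x) (at 0)"
  and group_bclin: "bounded_clinear (TS t)"
  using generates by (auto simp: generates_group_def C0_group_def bounded_clinearD)

lemma group_norm [simp]: "norm (TS t x) = norm x"
  using isometric by (simp add: isometric_def)

lemma group_inverse [simp]: "TS (- t) (TS t x) = x" "TS t (TS (- t) x) = x"
  using group_add[of "- t" t x] group_add[of t "- t" x] by (simp_all add: group_0)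

lemma group_diff: "TS t (x - y) = TS t x - TS t y"
  and group_scaleR: "TS t (r *\<^sub>R x) = r *\<^sub>R TS t x"
  using group_blin[of t] by (simp_all add: linear_diff linear_scale bounded_linear.linear)

lemma group_generatorI: "((\<lambda>h. (TS h x - x) /\<^sub>R h) \<longlongrightarrow> y) (at 0) \<Longrightarrow> x \<in> DS \<and> S x = y"
  using generates unfolding generates_group_def
  by (metis (mono_tags, lifting) mem_Collect_eq tendsto_unique trivial_limit_at)

lemma group_generator_limit: "x \<in> DS \<Longrightarrow> ((\<lambda>h. (TS h x - x) /\<^sub>R h) \<longlongrightarrow> S x) (at 0)"
  using generates unfolding generates_group_def by blast

lemma group_DS: "x \<in> DS \<Longrightarrow> TS t x \<in> DS \<and> S (TS t x) = TS t (S x)"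
proof (rule group_generatorI)
  assume "x \<in> DS"
  then have "((\<lambda>h. TS t ((TS h x - x) /\<^sub>R h)) \<longlongrightarrow> TS t (S x)) (at 0)"
    by (intro bounded_linear.tendsto[OF group_blin] group_generator_limit)
  moreover have "TS t ((TS h x - x) /\<^sub>R h) = (TS h (TS t x) - TS t x) /\<^sub>R h" for h
    using group_add[of t h x] group_add[of h t x] by (simp add: group_diff group_scaleR add.commute)
  ultimately show "((\<lambda>h. (TS h (TS t x) - TS t x) /\<^sub>R h) \<longlongrightarrow> TS t (S x)) (at 0)"
    by simp
qed

text \<open>For a group of isometries a right derivative at \<open>0\<close> is a two-sided one, so the group,
  restricted to nonnegative times, is a semigroup with the same generator.\<close>

lemma right_derivative_imp_two_sided:
  assumes "((\<lambda>h. (TS h x - x) /\<^sub>R h) \<longlongrightarrow> y) (at_right 0)"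
  shows "((\<lambda>h. (TS h x - x) /\<^sub>R h) \<longlongrightarrow> y) (at 0)"
proof -
  let ?q = "\<lambda>h. (TS h x - x) /\<^sub>R h"
  have "((\<lambda>h. TS h y) \<longlongrightarrow> y) (at_left 0)"
    using group_at_0[of y] by (simp add: filterlim_at_split)
  then have "((\<lambda>h. TS (- h) y) \<longlongrightarrow> y) (at_right 0)"
    using filterlim_at_left_to_right[of "\<lambda>h. TS h y" "nhds y" 0] by simp
  moreover have "((\<lambda>h. TS (- h) (?q h - y)) \<longlongrightarrow> 0) (at_right 0)"
    using assms by (intro tendsto_norm_zero_cancel[where f = "\<lambda>h. TS (- h) (?q h - y)"])
      (simp add: tendsto_norm_zero_iff LIM_zero_iff)
  ultimately have "((\<lambda>h. TS (- h) (?q h - y) + TS (- h) y) \<longlongrightarrow> 0 + y) (at_right 0)"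
    by (intro tendsto_add)
  moreover have "TS (- h) (?q h - y) + TS (- h) y = ?q (- h)" for h
    by (simp add: group_diff group_scaleR scaleR_diff_right)
  ultimately have "(?q \<longlongrightarrow> y) (at_left 0)"
    using filterlim_at_left_to_right[of ?q "nhds y" 0] by simp
  then show ?thesis
    using assms by (simp add: filterlim_at_split)
qed

lemma group_generates_semigroup: "generates_semigroup DS S TS"
proof -
  have right: "(f \<longlongrightarrow> l) (at_right 0)" if "(f \<longlongrightarrow> l) (at 0)" for f :: "real \<Rightarrow> 'w" and l
    using that by (simp add: filterlim_at_split)
  have "DS = {x. \<exists>y. ((\<lambda>h. (TS h x - x) /\<^sub>R h) \<longlongrightarrow> y) (at_right 0)}"
    using right group_generator_limit right_derivative_imp_two_sided group_generatorI by blast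
  then show ?thesis
    unfolding generates_semigroup_def C0_semigroup_def
    using right group_generator_limit group_at_0 group_0 group_add group_bclin by auto
qed

sublocale semi: bounded_C0_semigroup TS DS S 1
  by unfold_locales (auto simp: group_generates_semigroup)

lemma group_uniformly_continuous: "uniformly_continuous_on UNIV (\<lambda>t. TS t x)"
  unfolding uniformly_continuous_on_def
proof (intro allI impI)
  fix e :: real assume "e > 0"
  then obtain d where d: "d > 0" "\<And>h. h \<noteq> 0 \<Longrightarrow> dist h 0 < d \<Longrightarrow> dist (TS h x) x < e"
    using tendstoD[OF group_at_0[of x], of e] unfolding eventually_at by blast
  have "dist (TS s x) (TS t x) < e" if "dist s t < d" for s t
  proof (cases "s = t")
    case False
    have "TS s x - TS t x = TS t (TS (s - t) x - x)"
      using group_add[of t "s - t" x] by (simp add: group_diff)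
    then have "dist (TS s x) (TS t x) = dist (TS (s - t) x) x"
      by (simp add: dist_norm)
    then show ?thesis
      using d(2)[of "s - t"] that False by (simp add: dist_norm)
  qed (use \<open>e > 0\<close> in simp)
  then show "\<exists>d>0. \<forall>s\<in>UNIV. \<forall>t\<in>UNIV. dist t s < d \<longrightarrow> dist (TS t x) (TS s x) < e"
    using d(1) by blast
qed

lemma group_continuous: "continuous_on X (\<lambda>t. TS t x)"
  using uniformly_continuous_imp_continuous[OF group_uniformly_continuous] continuous_on_subset by blast

end

locale plant_exosystem =
  plant: bounded_C0_semigroup T D G M + exo: isometric_group TS DS S
  for T :: "real \<Rightarrow> 'z::complex_banach \<Rightarrow> 'z" and D :: "'z set" and G :: "'z \<Rightarrow> 'z" and M :: real
    and TS :: "real \<Rightarrow> 'w::complex_banach \<Rightarrow> 'w" and DS :: "'w set" and S :: "'w \<Rightarrow> 'w" +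
  fixes \<Delta> :: "'w \<Rightarrow> 'z"
  assumes Delta: "bounded_clinear \<Delta>"
begin

lemma Delta_linear: "bounded_linear \<Delta>"
  using Delta by (rule bounded_clinearD)

lemma forcing_continuous:
  assumes "continuous_on X g" "\<And>s. s \<in> X \<Longrightarrow> g s \<ge> 0" "continuous_on X h"
  shows "continuous_on X (\<lambda>s. T (g s) (\<Delta> (TS (h s) w)))"
proof (rule plant.continuous_on_T[OF _ assms(1,2)])
  have "continuous_on X (\<lambda>s. TS (h s) w)"
    using assms(3) by (intro continuous_on_compose2[OF exo.group_continuous[of UNIV]]) auto
  then show "continuous_on X (\<lambda>s. \<Delta> (TS (h s) w))"
    by (rule bounded_linear.continuous_on[OF Delta_linear])
qed

definition sylvester :: "('w \<Rightarrow> 'z) \<Rightarrow> bool" where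
  "sylvester \<Psi> \<longleftrightarrow> bounded_clinear \<Psi> \<and> (\<forall>w\<in>DS. \<Psi> w \<in> D \<and> G (\<Psi> w) + \<Delta> w = \<Psi> (S w))"

text \<open>A solution of the Sylvester equation describes the steady state: \<open>\<Psi> T\<^sub>S(t) w\<close> is itself a
  mild solution of the forced equation. For \<open>w\<close> in \<open>D(S)\<close> the integrand is the derivative of
  \<open>T(t - s) \<Psi> T\<^sub>S(s) w\<close> in \<open>s\<close>; both sides are continuous in \<open>w\<close>, and \<open>D(S)\<close> is dense.\<close>

lemma steady_state:
  assumes syl: "sylvester \<Psi>" and t: "t \<ge> 0"
  shows "integral {0..t} (\<lambda>s. T (t - s) (\<Delta> (TS s w))) = \<Psi> (TS t w) - T t (\<Psi> w)"
proof -
  have lin: "bounded_linear \<Psi>" and eq: "\<And>w. w \<in> DS \<Longrightarrow> \<Psi> w \<in> D \<and> G (\<Psi> w) + \<Delta> w = \<Psi> (S w)"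
    using syl by (auto simp: sylvester_def bounded_clinearD)
  have cont: "continuous_on {0..t} (\<lambda>s. T (t - s) (\<Delta> (TS s w)))" for w
    by (intro forcing_continuous continuous_intros) auto
  have on_DS: "integral {0..t} (\<lambda>s. T (t - s) (\<Delta> (TS s w))) = \<Psi> (TS t w) - T t (\<Psi> w)"
    if w: "w \<in> DS" for w
  proof -
    have "((\<lambda>s. T (t - s) (\<Delta> (TS s w))) has_integral
        T (t - t) (\<Psi> (TS t w)) - T (t - 0) (\<Psi> (TS 0 w))) {0..t}"
    proof (rule fundamental_theorem_of_calculus[OF t])
      fix s assume s: "s \<in> {0..t}"
      have TSw: "TS s w \<in> DS" "S (TS s w) = TS s (S w)"
        using exo.group_DS[OF w] by auto
      have "((\<lambda>r. T (t - r) (\<Psi> (TS r w))) has_vector_derivative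
          (- T (t - s) (G (\<Psi> (TS s w))) + T (t - s) (\<Psi> (TS s (S w))))) (at s within {0..t})"
      proof (rule has_vector_derivative_operator_family[where M = M and U = "\<lambda>r. T (t - r)"])
        show "linear (T (t - r))" if "r \<in> {0..t}" for r
          using that by (intro bounded_linear.linear plant.blin) auto
        show "norm (T (t - r) x) \<le> M * norm x" if "r \<in> {0..t}" for r x
          using that by (intro plant.bound) auto
        show "continuous_on {0..t} (\<lambda>r. T (t - r) (\<Psi> (TS s (S w))))"
          by (intro plant.continuous_on_T continuous_intros) auto
        show "((\<lambda>r. T (t - r) (\<Psi> (TS s w))) has_vector_derivative - T (t - s) (G (\<Psi> (TS s w)))) (at s within {0..t})"
          using eq[OF TSw(1)] s by (intro plant.orbit_backward_derivative) auto
        have "((\<lambda>r. TS r w) has_vector_derivative TS s (S w)) (at s within {0..t})"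
          using s by (intro exo.semi.orbit_derivative[OF w]) auto
        then show "((\<lambda>r. \<Psi> (TS r w)) has_vector_derivative \<Psi> (TS s (S w))) (at s within {0..t})"
          by (rule bounded_linear.has_vector_derivative[OF lin])
      qed (use s in auto)
      moreover have "- T (t - s) (G (\<Psi> (TS s w))) + T (t - s) (\<Psi> (TS s (S w))) = T (t - s) (\<Delta> (TS s w))"
      proof -
        have "\<Delta> (TS s w) = \<Psi> (TS s (S w)) - G (\<Psi> (TS s w))"
          using eq[OF TSw(1)] TSw(2) by (simp add: algebra_simps)
        then show ?thesis
          using s by (simp add: plant.T_diff)
      qed
      ultimately show "((\<lambda>r. T (t - r) (\<Psi> (TS r w))) has_vector_derivative T (t - s) (\<Delta> (TS s w))) (at s within {0..t})"
        by simp
    qed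
    then show ?thesis
      by (simp add: has_integral_iff exo.group_0)
  qed
  obtain W where W: "\<And>n. W n \<in> DS" "W \<longlonglongrightarrow> w"
    using exo.semi.D_sequence[of w] by blast
  obtain K where K: "K > 0" "\<And>x. norm (\<Delta> x) \<le> norm x * K"
    using bounded_linear.pos_bounded[OF Delta_linear] by blast
  let ?I = "\<lambda>w. integral {0..t} (\<lambda>s. T (t - s) (\<Delta> (TS s w)))"
  have "norm (?I (W n) - ?I w) \<le> (M * (K * norm (W n - w))) * (t - 0)" for n
  proof -
    have "?I (W n) - ?I w = integral {0..t} (\<lambda>s. T (t - s) (\<Delta> (TS s (W n))) - T (t - s) (\<Delta> (TS s w)))"
      by (intro integral_diff[symmetric] integrable_continuous_interval cont)
    also have "norm \<dots> \<le> (M * (K * norm (W n - w))) * (t - 0)"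
    proof (rule integral_bound[OF t])
      fix s assume s: "s \<in> {0..t}"
      have "T (t - s) (\<Delta> (TS s (W n))) - T (t - s) (\<Delta> (TS s w)) = T (t - s) (\<Delta> (TS s (W n - w)))"
        using s Delta_linear by (simp add: plant.T_diff exo.group_diff linear_diff bounded_linear.linear)
      also have "norm \<dots> \<le> M * norm (\<Delta> (TS s (W n - w)))"
        using s by (intro plant.bound) auto
      also have "\<dots> \<le> M * (K * norm (W n - w))"
        using K(2)[of "TS s (W n - w)"] plant.M_ge_1 by (intro mult_left_mono) (auto simp: mult.commute)
      finally show "norm (T (t - s) (\<Delta> (TS s (W n))) - T (t - s) (\<Delta> (TS s w))) \<le> M * (K * norm (W n - w))" .
    qed (intro continuous_on_diff cont)
    finally show ?thesis .
  qed
  then have "\<forall>\<^sub>F n in sequentially. norm (?I (W n) - ?I w) \<le> M * (K * norm (W n - w)) * t"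
    by (simp add: always_eventually)
  moreover have "(\<lambda>n. M * (K * norm (W n - w)) * t) \<longlonglongrightarrow> 0"
    using W(2) by (intro tendsto_mult_left_zero tendsto_mult_right_zero)
      (simp add: tendsto_norm_zero_iff LIM_zero_iff)
  ultimately have "(\<lambda>n. ?I (W n) - ?I w) \<longlonglongrightarrow> 0"
    by (rule Lim_null_comparison)
  then have "(\<lambda>n. ?I (W n)) \<longlonglongrightarrow> ?I w"
    by (rule LIM_zero_cancel)
  moreover have "(\<lambda>n. ?I (W n)) \<longlonglongrightarrow> \<Psi> (TS t w) - T t (\<Psi> w)"
    unfolding on_DS[OF W(1)]
    by (intro tendsto_diff bounded_linear.tendsto[OF lin] bounded_linear.tendsto[OF exo.group_blin]
        bounded_linear.tendsto[OF plant.blin[OF t]] W(2))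
  ultimately show ?thesis
    by (rule LIMSEQ_unique)
qed

lemma tracking_error_steady_state:
  assumes "sylvester \<Psi>" "t \<ge> 0"
  shows "tracking_error T TS \<Delta> C Q z0 w0 t = C (T t (z0 - \<Psi> w0) + \<Psi> (TS t w0)) - Q (TS t w0)"
  using assms by (simp add: tracking_error_def mild_solution_def steady_state plant.T_diff algebra_simps)

text \<open>The integrals in the definition of conformity are mild solutions run from the past:
  substituting \<open>t = \<tau> - s\<close> gives \<open>\<Psi> w - T(\<tau>) \<Psi> T\<^sub>S(-\<tau>) w\<close>. The remainder vanishes in the limit,
  since on \<open>D(S)\<close> its argument stays in \<open>D(G)\<close> with bounded graph norm.\<close>

lemma sylvester_imp_conform:
  assumes syl: "sylvester \<Psi>" and dec: "decay_exponent D G T \<alpha>"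
  shows "conform T DS TS \<Delta>"
proof -
  have clin: "bounded_clinear \<Psi>" and eq: "\<And>w. w \<in> DS \<Longrightarrow> \<Psi> w \<in> D \<and> G (\<Psi> w) + \<Delta> w = \<Psi> (S w)"
    using syl by (auto simp: sylvester_def)
  have lin: "bounded_linear \<Psi>"
    using clin by (rule bounded_clinearD)
  obtain K where K: "K > 0" "\<And>x. norm (\<Psi> x) \<le> norm x * K"
    using bounded_linear.pos_bounded[OF lin] by blast
  obtain K' where K': "K' > 0" "\<And>x. norm (\<Delta> x) \<le> norm x * K'"
    using bounded_linear.pos_bounded[OF Delta_linear] by blast
  obtain N where al: "\<alpha> > 0" and N: "N > 0"
      "\<And>t x. t > 0 \<Longrightarrow> x \<in> D \<Longrightarrow> norm (T t x) \<le> N * t powr (- 1 / \<alpha>) * norm (G x)"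
    using plant.decay_exponent_on_domain[OF dec] by blast
  have int: "integral {0..\<tau>} (\<lambda>t. T t (\<Delta> (TS (- t) w))) = \<Psi> w - T \<tau> (\<Psi> (TS (- \<tau>) w))"
    if tau: "\<tau> \<ge> 0" for \<tau> w
  proof -
    let ?f = "\<lambda>t. T t (\<Delta> (TS (- t) w))"
    have "(?f has_integral integral {0..\<tau>} ?f) {0..\<tau>}"
      by (intro integrable_integral integrable_continuous_interval forcing_continuous continuous_intros) auto
    then have "((\<lambda>x. ?f (- x)) has_integral integral {0..\<tau>} ?f) {- \<tau>..- 0}"
      by (rule has_integral_reflect_real[THEN iffD2])
    from has_integral_shift_real_ivl[OF this, of "- \<tau>"]
    have "((\<lambda>s. T (\<tau> - s) (\<Delta> (TS (s - \<tau>) w))) has_integral integral {0..\<tau>} ?f) {0..\<tau>}"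
      by simp
    moreover have "TS (s - \<tau>) w = TS s (TS (- \<tau>) w)" for s
      using exo.group_add[of s "- \<tau>" w] by simp
    ultimately show ?thesis
      using steady_state[OF syl tau, of "TS (- \<tau>) w"] by (simp add: has_integral_iff)
  qed
  have "((\<lambda>\<tau>. integral {0..\<tau>} (\<lambda>t. T t (\<Delta> (TS (- t) w)))) \<longlongrightarrow> \<Psi> w) at_top" if w: "w \<in> DS" for w
  proof -
    have "((\<lambda>\<tau>. T \<tau> (\<Psi> (TS (- \<tau>) w))) \<longlongrightarrow> 0) at_top"
    proof (rule Lim_null_comparison)
      show "\<forall>\<^sub>F \<tau> in at_top. norm (T \<tau> (\<Psi> (TS (- \<tau>) w))) \<le> N * \<tau> powr (- 1 / \<alpha>) * (norm (S w) * K + norm w * K')"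
        using eventually_gt_at_top[of 0]
      proof eventually_elim
        fix \<tau> :: real assume tau: "\<tau> > 0"
        let ?v = "TS (- \<tau>) w"
        have v: "?v \<in> DS" "S ?v = TS (- \<tau>) (S w)"
          using exo.group_DS[OF w] by auto
        have "G (\<Psi> ?v) = \<Psi> (S ?v) - \<Delta> ?v"
          using eq[OF v(1)] by (simp add: algebra_simps)
        then have "norm (G (\<Psi> ?v)) \<le> norm (S w) * K + norm w * K'"
          using norm_triangle_ineq4[of "\<Psi> (S ?v)" "\<Delta> ?v"] K(2)[of "S ?v"] K'(2)[of ?v] v(2) by simp
        then have "N * \<tau> powr (- 1 / \<alpha>) * norm (G (\<Psi> ?v)) \<le> N * \<tau> powr (- 1 / \<alpha>) * (norm (S w) * K + norm w * K')"
          using N by (intro mult_left_mono) auto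
        then show "norm (T \<tau> (\<Psi> ?v)) \<le> N * \<tau> powr (- 1 / \<alpha>) * (norm (S w) * K + norm w * K')"
          using N(2)[OF tau conjunct1[OF eq[OF v(1)]]] by simp
      qed
      show "((\<lambda>\<tau>. N * \<tau> powr (- 1 / \<alpha>) * (norm (S w) * K + norm w * K')) \<longlongrightarrow> 0) at_top"
        by (rule plant.powr_neg_tendsto_0[OF al])
    qed
    from tendsto_diff[OF tendsto_const this, of "\<Psi> w"]
    have "((\<lambda>\<tau>. \<Psi> w - T \<tau> (\<Psi> (TS (- \<tau>) w))) \<longlongrightarrow> \<Psi> w) at_top"
      by simp
    then show ?thesis
      by (rule Lim_transform_eventually)
        (use int in \<open>auto intro!: eventually_at_top_linorderI[of 0]\<close>)
  qed
  moreover have "bounded_clinear_on DS \<Psi>"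
    unfolding bounded_clinear_on_def using K lin clin
    by (auto simp: linear_add bounded_linear.linear bounded_clinear_scaleC mult.commute)
  ultimately show ?thesis
    unfolding conform_def using Delta by blast
qed

end

lemma bounded_clinear_on_extension:
  fixes F :: "'a::complex_normed_vector \<Rightarrow> 'b::complex_banach"
  assumes F: "bounded_clinear_on X F" and dense: "closure X = UNIV"
    and add: "\<And>x y. x \<in> X \<Longrightarrow> y \<in> X \<Longrightarrow> x + y \<in> X" and scale: "\<And>c x. x \<in> X \<Longrightarrow> c *\<^sub>C x \<in> X"
  obtains g where "bounded_clinear g" "\<And>x. x \<in> X \<Longrightarrow> g x = F x"
proof -
  obtain k where Fadd: "\<And>x y. x \<in> X \<Longrightarrow> y \<in> X \<Longrightarrow> F (x + y) = F x + F y"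
    and Fscale: "\<And>c x. x \<in> X \<Longrightarrow> F (c *\<^sub>C x) = c *\<^sub>C F x" and k: "\<And>x. x \<in> X \<Longrightarrow> norm (F x) \<le> k * norm x"
    using F unfolding bounded_clinear_on_def by blast
  have minus: "(-1) *\<^sub>C x = - x" for x :: "'c::complex_normed_vector"
    using scaleR_scaleC[of "-1" x] by simp
  have Fdiff: "x - y \<in> X \<and> F (x - y) = F x - F y" if "x \<in> X" "y \<in> X" for x y
    using add[OF that(1) scale[OF that(2)], of "-1"] Fadd[OF that(1) scale[OF that(2)], of "-1"] Fscale[OF that(2), of "-1"]
    by (simp add: minus)
  have "uniformly_continuous_on X F"
    unfolding uniformly_continuous_on_def
  proof (intro allI impI)
    fix e :: real assume e: "e > 0"
    have "dist (F x) (F y) < e" if "x \<in> X" "y \<in> X" "dist x y < e / (\<bar>k\<bar> + 1)" for x y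
    proof -
      have "dist (F x) (F y) \<le> k * norm (x - y)"
        using k[of "x - y"] Fdiff[OF that(1,2)] by (simp add: dist_norm)
      also have "\<dots> \<le> (\<bar>k\<bar> + 1) * dist x y"
        by (auto simp: dist_norm intro!: mult_right_mono)
      also have "\<dots> < e"
        using that(3) by (simp add: pos_less_divide_eq mult.commute add_nonneg_pos)
      finally show ?thesis .
    qed
    then show "\<exists>d>0. \<forall>x\<in>X. \<forall>x'\<in>X. dist x' x < d \<longrightarrow> dist (F x') (F x) < e"
      using e by (intro exI[of _ "e / (\<bar>k\<bar> + 1)"]) auto
  qed
  then obtain g where g: "uniformly_continuous_on (closure X) g" "\<And>x. x \<in> X \<Longrightarrow> F x = g x"
    by (rule uniformly_continuous_on_extension_on_closure) blast
  have "continuous_on UNIV g"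
    using uniformly_continuous_imp_continuous[OF g(1)] dense by simp
  then have lim: "(\<lambda>n. g (x n)) \<longlonglongrightarrow> g a" if "x \<longlonglongrightarrow> a" for x :: "nat \<Rightarrow> 'a" and a
    using that by (simp add: continuous_on_tendsto_compose)
  have seq: "\<exists>x. (\<forall>n. x n \<in> X) \<and> x \<longlonglongrightarrow> a" for a
    using dense closure_sequential[of a X] by auto
  have gadd: "g (a + b) = g a + g b" for a b
  proof -
    obtain x y where x: "\<And>n. x n \<in> X" "x \<longlonglongrightarrow> a" and y: "\<And>n. y n \<in> X" "y \<longlonglongrightarrow> b"
      using seq by metis
    have "(\<lambda>n. g (x n + y n)) \<longlonglongrightarrow> g (a + b)" "(\<lambda>n. g (x n) + g (y n)) \<longlonglongrightarrow> g a + g b"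
      by (intro lim tendsto_add x y)+
    moreover have "g (x n + y n) = g (x n) + g (y n)" for n
      using Fadd[OF x(1) y(1)] g(2) x(1) y(1) add by metis
    ultimately show ?thesis
      using LIMSEQ_unique by simp
  qed
  have gscale: "g (c *\<^sub>C a) = c *\<^sub>C g a" for c a
  proof -
    obtain x where x: "\<And>n. x n \<in> X" "x \<longlonglongrightarrow> a"
      using seq by metis
    have "(\<lambda>n. g (c *\<^sub>C x n)) \<longlonglongrightarrow> g (c *\<^sub>C a)" "(\<lambda>n. c *\<^sub>C g (x n)) \<longlonglongrightarrow> c *\<^sub>C g a"
      by (intro lim bounded_linear.tendsto[OF bounded_linear_scaleC] x)+
    moreover have "g (c *\<^sub>C x n) = c *\<^sub>C g (x n)" for n
      using Fscale[OF x(1)] g(2) x(1) scale by metis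
    ultimately show ?thesis
      using LIMSEQ_unique by simp
  qed
  have gnorm: "norm (g a) \<le> norm a * k" for a
  proof -
    obtain x where x: "\<And>n. x n \<in> X" "x \<longlonglongrightarrow> a"
      using seq by metis
    show ?thesis
    proof (rule LIMSEQ_le)
      show "(\<lambda>n. norm (g (x n))) \<longlonglongrightarrow> norm (g a)" "(\<lambda>n. norm (x n) * k) \<longlonglongrightarrow> norm a * k"
        by (intro tendsto_intros lim x)+
      show "\<exists>N. \<forall>n\<ge>N. norm (g (x n)) \<le> norm (x n) * k"
        using k x(1) g(2) by (simp add: mult.commute)
    qed
  qed
  have "bounded_clinear g"
    unfolding bounded_clinear_def
    using gscale by (auto intro!: bounded_linear_intro[where K = k] gadd gnorm simp: scaleR_scaleC)
  then show ?thesis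
    using that g(2) by simp
qed

context plant_exosystem
begin

text \<open>Conversely, the operator of conformity solves the Sylvester equation: applying \<open>T(h)\<close> shifts
  the improper integral, so that \<open>T(h) \<Psi> w = \<Psi> T\<^sub>S(h) w - \<integral> T(r) \<Delta> T\<^sub>S(h - r) w dr\<close> over
  \<open>[0, h]\<close>, and this can be differentiated at \<open>h = 0\<close>.\<close>

lemma conform_imp_sylvester:
  assumes "conform T DS TS \<Delta>"
  obtains \<Psi> where "sylvester \<Psi>"
proof -
  let ?I = "\<lambda>w \<tau>. integral {0..\<tau>} (\<lambda>t. T t (\<Delta> (TS (- t) w)))"
  obtain F where F: "bounded_clinear_on DS F" "\<And>w. w \<in> DS \<Longrightarrow> (?I w \<longlongrightarrow> F w) at_top"
    using assms by (auto simp: conform_def)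
  obtain \<Psi> where Pi: "bounded_clinear \<Psi>" "\<And>w. w \<in> DS \<Longrightarrow> \<Psi> w = F w"
    using bounded_clinear_on_extension[OF F(1) exo.semi.D_dense] exo.semi.D_add exo.semi.D_scaleC by blast
  have lin: "bounded_linear \<Psi>"
    using Pi(1) by (rule bounded_clinearD)
  interpret Pi: bounded_linear \<Psi> by (rule lin)
  interpret Delta: bounded_linear \<Delta> by (rule Delta_linear)
  obtain K where K: "K > 0" "\<And>x. norm (\<Delta> x) \<le> norm x * K"
    using Delta.pos_bounded by blast
  have lim: "(?I w \<longlongrightarrow> \<Psi> w) at_top" if "w \<in> DS" for w
    using F(2) Pi(2) that by simp
  have cont: "continuous_on {a..b} (\<lambda>t. T t (\<Delta> (TS (c - t) w)))" if "a \<ge> 0" for a b c w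
    using that by (intro forcing_continuous continuous_intros) auto
  have "\<Psi> w \<in> D \<and> G (\<Psi> w) = \<Psi> (S w) - \<Delta> w" if w: "w \<in> DS" for w
  proof (rule plant.generatorI)
    let ?J = "\<lambda>h. integral {0..h} (\<lambda>r. T r (\<Delta> (TS (h - r) w)))"
    have shift: "T h (\<Psi> w) = \<Psi> (TS h w) - ?J h" if h: "h > 0" for h
    proof -
      have eq: "T h (?I w \<tau>) = ?I (TS h w) (\<tau> + h) - ?J h" if tau: "\<tau> \<ge> 0" for \<tau>
      proof -
        have TSw: "TS (- t) (TS h w) = TS (h - t) w" for t
          using exo.group_add[of "- t" h w] by simp
        have c0: "continuous_on {0..\<tau>} (\<lambda>t. T t (\<Delta> (TS (- t) w)))"
          using cont[of 0 \<tau> 0 w] by simp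
        have "T h (?I w \<tau>) = integral {0..\<tau>} (T h \<circ> (\<lambda>t. T t (\<Delta> (TS (- t) w))))"
          using h by (intro integral_linear[symmetric] integrable_continuous_interval c0 plant.blin) auto
        also have "\<dots> = integral {0..\<tau>} ((\<lambda>t. T t (\<Delta> (TS (h - t) w))) \<circ> (+) h)"
          using h by (intro integral_cong) (auto simp: plant.T_add)
        also have "\<dots> = integral {h..\<tau> + h} (\<lambda>t. T t (\<Delta> (TS (h - t) w)))"
          using integral_shift_Icc_real[of 0 \<tau> "\<lambda>t. T t (\<Delta> (TS (h - t) w))" h] by simp
        also have "\<dots> = integral {0..\<tau> + h} (\<lambda>t. T t (\<Delta> (TS (h - t) w))) - ?J h"
          using Henstock_Kurzweil_Integration.integral_combine[of 0 h "\<tau> + h" "\<lambda>t. T t (\<Delta> (TS (h - t) w))"] h tau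
          by (simp add: algebra_simps integrable_continuous_interval cont)
        finally show ?thesis
          by (simp add: TSw)
      qed
      have "((\<lambda>\<tau>. T h (?I w \<tau>)) \<longlongrightarrow> T h (\<Psi> w)) at_top"
        using h by (intro bounded_linear.tendsto[OF plant.blin] lim w) auto
      moreover have "((\<lambda>\<tau>. ?I (TS h w) (\<tau> + h) - ?J h) \<longlongrightarrow> \<Psi> (TS h w) - ?J h) at_top"
        by (intro tendsto_diff tendsto_const filterlim_compose[OF lim]
            filterlim_tendsto_add_at_top[OF tendsto_const filterlim_ident, of h, unfolded add.commute[of h]])
          (use exo.group_DS[OF w] in auto)
      then have "((\<lambda>\<tau>. T h (?I w \<tau>)) \<longlongrightarrow> \<Psi> (TS h w) - ?J h) at_top"
        by (rule Lim_transform_eventually)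
          (use eq in \<open>auto intro!: eventually_at_top_linorderI[of 0]\<close>)
      ultimately show ?thesis
        using tendsto_unique trivial_limit_at_top_linorder by blast
    qed
    have Jlim: "((\<lambda>h. ?J h /\<^sub>R h) \<longlongrightarrow> \<Delta> w) (at_right 0)"
    proof -
      let ?A = "\<lambda>h. integral {0..h} (\<lambda>r. T r (\<Delta> w))"
      have "\<forall>\<^sub>F h in at_right 0. norm (?J h /\<^sub>R h - ?A h /\<^sub>R h) \<le> h * (M * K * norm (S w))"
        unfolding eventually_at_filter
      proof (intro always_eventually allI impI)
        fix h :: real assume "h \<in> {0<..}"
        then have h: "h > 0" by simp
        have c1: "continuous_on {0..h} (\<lambda>r. T r (\<Delta> w))"
          by (rule continuous_on_subset[OF plant.orbit_continuous]) auto
        have "norm (integral {0..h} (\<lambda>r. T r (\<Delta> (TS (h - r) w)) - T r (\<Delta> w))) \<le> (M * (h * norm (S w) * K)) * (h - 0)"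
        proof (rule integral_bound)
          fix r assume r: "r \<in> {0..h}"
          have "norm (TS (h - r) w - w) \<le> h * norm (S w)"
            using exo.semi.orbit_lipschitz[OF w, of "h - r"] r mult_right_mono[of "h - r" h "norm (S w)"] by simp
          then have "norm (\<Delta> (TS (h - r) w - w)) \<le> h * norm (S w) * K"
            using order_trans[OF K(2) mult_right_mono[of _ _ K]] K(1) by simp
          then have "norm (T r (\<Delta> (TS (h - r) w - w))) \<le> M * (h * norm (S w) * K)"
            using r plant.M_ge_1 by (intro order_trans[OF plant.bound mult_left_mono]) auto
          then show "norm (T r (\<Delta> (TS (h - r) w)) - T r (\<Delta> w)) \<le> M * (h * norm (S w) * K)"
            using r by (simp add: Delta.diff plant.T_diff)
        qed (use h in \<open>auto intro!: continuous_on_diff cont c1\<close>)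
        moreover have "integral {0..h} (\<lambda>r. T r (\<Delta> (TS (h - r) w)) - T r (\<Delta> w)) = ?J h - ?A h"
          by (intro integral_diff integrable_continuous_interval cont c1) auto
        ultimately have "norm (?J h - ?A h) / h \<le> M * (h * norm (S w) * K)"
          using h by (simp add: pos_divide_le_eq)
        moreover have "norm (?J h /\<^sub>R h - ?A h /\<^sub>R h) = norm (?J h - ?A h) / h"
          using h by (simp add: divide_inverse mult.commute flip: scaleR_diff_right)
        ultimately show "norm (?J h /\<^sub>R h - ?A h /\<^sub>R h) \<le> h * (M * K * norm (S w))"
          by (simp add: mult_ac)
      qed
      moreover have "((\<lambda>h. h * (M * K * norm (S w))) \<longlongrightarrow> 0) (at_right 0)"
        by (intro tendsto_mult_left_zero tendsto_ident_at)
      ultimately have "((\<lambda>h. ?J h /\<^sub>R h - ?A h /\<^sub>R h) \<longlongrightarrow> 0) (at_right 0)"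
        by (rule Lim_null_comparison)
      from tendsto_add[OF this plant.orbit_average_at_0[of "\<Delta> w"]] show ?thesis
        by simp
    qed
    have "((\<lambda>h. \<Psi> ((TS h w - w) /\<^sub>R h) - ?J h /\<^sub>R h) \<longlongrightarrow> \<Psi> (S w) - \<Delta> w) (at_right 0)"
      by (intro tendsto_diff Pi.tendsto exo.semi.generator_limit w Jlim)
    moreover have "\<forall>\<^sub>F h in at_right 0. \<Psi> ((TS h w - w) /\<^sub>R h) - ?J h /\<^sub>R h = (T h (\<Psi> w) - \<Psi> w) /\<^sub>R h"
      using shift by (auto simp: eventually_at_filter Pi.diff Pi.scaleR scaleR_diff_right)
    ultimately show "((\<lambda>h. (T h (\<Psi> w) - \<Psi> w) /\<^sub>R h) \<longlongrightarrow> \<Psi> (S w) - \<Delta> w) (at_right 0)"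
      by (rule Lim_transform_eventually)
  qed
  then have "sylvester \<Psi>"
    unfolding sylvester_def using Pi(1) by simp
  then show ?thesis
    by (rule that)
qed

end

section \<open>The state feedback regulation problem\<close>

lemma bounded_clinear_add: "bounded_clinear f \<Longrightarrow> bounded_clinear g \<Longrightarrow> bounded_clinear (\<lambda>x. f x + g x)"
  by (simp add: bounded_clinear_def bounded_linear_add scaleC_add_right)

lemma bounded_clinear_diff: "bounded_clinear f \<Longrightarrow> bounded_clinear g \<Longrightarrow> bounded_clinear (\<lambda>x. f x - g x)"
  by (simp add: bounded_clinear_def bounded_linear_sub
      linear_diff[OF bounded_linear.linear[OF bounded_linear_scaleC]])

lemma bounded_clinear_compose: "bounded_clinear f \<Longrightarrow> bounded_clinear g \<Longrightarrow> bounded_clinear (\<lambda>x. f (g x))"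
  using bounded_linear_compose[of f g] by (simp add: bounded_clinear_def)

text \<open>Started at \<open>\<Psi> w\<close>, the plant follows its steady state and the tracking error is
  \<open>(C \<Psi> - Q) T\<^sub>S(t) w\<close>. If it vanishes at infinity, then \<open>(C \<Psi> - Q) w = 0\<close> for admissible reference
  signals.\<close>

lemma (in plant_exosystem) regulation_imp_output_equation:
  fixes C :: "'z \<Rightarrow> 'y::complex_banach"
  assumes syl: "sylvester \<Psi>" and C: "bounded_clinear C" and Q: "bounded_clinear Q"
    and adm: "admissible_reference_signals TYPE('y) TS"
    and err: "(tracking_error T TS \<Delta> C Q (\<Psi> w) w \<longlongrightarrow> 0) at_top"
  shows "C (\<Psi> w) = Q w"
proof -
  let ?R = "\<lambda>w. C (\<Psi> w) - Q w"
  have R: "bounded_clinear ?R"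
    using syl by (intro bounded_clinear_diff bounded_clinear_compose[OF C] Q) (simp add: sylvester_def)
  obtain K where K: "K > 0" "\<And>x. norm (?R x) \<le> norm x * K"
    using bounded_linear.pos_bounded[OF bounded_clinearD[OF R]] by blast
  have "(\<lambda>t. ?R (TS t w)) \<in> C0_plus"
    unfolding C0_plus_def
  proof (intro CollectI conjI)
    show "bounded (range (\<lambda>t. ?R (TS t w)))"
      unfolding bounded_iff using K(2)[of "TS _ w"] by auto
    show "uniformly_continuous_on UNIV (\<lambda>t. ?R (TS t w))"
      by (rule bounded_linear.uniformly_continuous_on[OF bounded_clinearD[OF R] exo.group_uniformly_continuous])
    show "((\<lambda>t. ?R (TS t w)) \<longlongrightarrow> 0) at_top"
    proof (rule Lim_transform_eventually[OF err])
      show "\<forall>\<^sub>F t in at_top. tracking_error T TS \<Delta> C Q (\<Psi> w) w t = ?R (TS t w)"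
        by (rule eventually_at_top_linorderI[of 0])
          (simp add: tracking_error_steady_state[OF syl] plant.T_zero)
    qed
  qed
  then have "?R w = 0"
    using adm R unfolding admissible_reference_signals_def by blast
  then show ?thesis
    by simp
qed

text \<open>Once \<open>C \<Psi> = Q\<close>, the tracking error is \<open>C T(t) (z0 - \<Psi> w0)\<close> and inherits the decay of the
  closed loop semigroup.\<close>

lemma (in plant_exosystem) output_equation_imp_regulation:
  assumes syl: "sylvester \<Psi>" and C: "bounded_clinear C" and CPi: "\<And>w. C (\<Psi> w) = Q w"
    and dec: "decay_exponent D G T \<alpha>"
  shows "(tracking_error T TS \<Delta> C Q z0 w0 \<longlongrightarrow> 0) at_top"
    and "z0 \<in> D \<Longrightarrow> w0 \<in> DS \<Longrightarrow> \<exists>m>0. \<forall>t>0. norm (tracking_error T TS \<Delta> C Q z0 w0 t) \<le> m * t powr (- 1 / \<alpha>)"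
proof -
  have lin: "bounded_linear C"
    by (rule bounded_clinearD[OF C])
  have e: "tracking_error T TS \<Delta> C Q z0 w0 t = C (T t (z0 - \<Psi> w0))" if "t \<ge> 0" for t
    by (simp add: tracking_error_steady_state[OF syl that] linear_add[OF bounded_linear.linear[OF lin]] CPi)
  have "((\<lambda>t. C (T t (z0 - \<Psi> w0))) \<longlongrightarrow> C 0) at_top"
    by (intro bounded_linear.tendsto[OF lin] plant.strongly_stable[OF dec])
  then show "(tracking_error T TS \<Delta> C Q z0 w0 \<longlongrightarrow> 0) at_top"
    unfolding linear_0[OF bounded_linear.linear[OF lin]]
    by (rule Lim_transform_eventually) (use e in \<open>auto intro!: eventually_at_top_linorderI[of 0]\<close>)
  assume "z0 \<in> D" "w0 \<in> DS"
  then have x: "z0 - \<Psi> w0 \<in> D"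
    using syl by (intro conjunct1[OF plant.D_diff]) (simp_all add: sylvester_def)
  obtain N where "\<alpha> > 0" and N: "N > 0"
      "\<And>t x. t > 0 \<Longrightarrow> x \<in> D \<Longrightarrow> norm (T t x) \<le> N * t powr (- 1 / \<alpha>) * norm (G x)"
    using plant.decay_exponent_on_domain[OF dec] by blast
  obtain K where K: "K > 0" "\<And>x. norm (C x) \<le> norm x * K"
    using bounded_linear.pos_bounded[OF lin] by blast
  let ?m = "N * (norm (G (z0 - \<Psi> w0)) + 1) * K"
  have "norm (tracking_error T TS \<Delta> C Q z0 w0 t) \<le> ?m * t powr (- 1 / \<alpha>)" if t: "t > 0" for t
  proof -
    have "norm (tracking_error T TS \<Delta> C Q z0 w0 t) \<le> norm (T t (z0 - \<Psi> w0)) * K"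
      using e[of t] t K(2) by simp
    also have "\<dots> \<le> (N * t powr (- 1 / \<alpha>) * (norm (G (z0 - \<Psi> w0)) + 1)) * K"
    proof (intro mult_right_mono order_trans[OF N(2)[OF t x]] mult_left_mono)
    qed (use N K in auto)
    finally show ?thesis
      by (simp add: mult_ac)
  qed
  moreover have "?m > 0"
    using N K by (intro mult_pos_pos) (auto intro: add_nonneg_pos)
  ultimately show "\<exists>m>0. \<forall>t>0. norm (tracking_error T TS \<Delta> C Q z0 w0 t) \<le> m * t powr (- 1 / \<alpha>)"
    by blast
qed

theorem theorem4p8:
  fixes DA :: "'z::complex_banach set" and A :: "'z \<Rightarrow> 'z" and TA :: "real \<Rightarrow> 'z \<Rightarrow> 'z"
    and B :: "'u::complex_banach \<Rightarrow> 'z" and C :: "'z \<Rightarrow> 'y::complex_banach"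
    and DS :: "'w::complex_banach set" and S :: "'w \<Rightarrow> 'w" and TS :: "real \<Rightarrow> 'w \<Rightarrow> 'w"
    and P :: "'w \<Rightarrow> 'z" and Q :: "'w \<Rightarrow> 'y"
    and K :: "'z \<Rightarrow> 'u" and L :: "'w \<Rightarrow> 'u" and TABK :: "real \<Rightarrow> 'z \<Rightarrow> 'z"
  assumes "generates_semigroup DA A TA"
    and "bounded_clinear B" and "bounded_clinear C"
    and "generates_group DS S TS" and "isometric TS"
    and "bounded_clinear P" and "bounded_clinear Q"
    and "bounded_clinear K"
    and "generates_semigroup DA (\<lambda>z. A z + B (K z)) TABK"
    and "bounded_semigroup TABK" and "polynomially_stable TABK"
    and "admissible_reference_signals TYPE('y) TS"
    and "bounded_clinear L"
  shows "solves_SFRP DA A B C DS TS P Q K L \<and> conform TABK DS TS (\<lambda>w. B (L w) + P w) \<longleftrightarrow>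
    (\<exists>Pi_op Gamma_op. bounded_clinear Pi_op \<and> bounded_clinear Gamma_op \<and> Pi_op ` DS \<subseteq> DA \<and>
       (\<forall>w. L w = Gamma_op w - K (Pi_op w)) \<and>
       (\<forall>w\<in>DS. A (Pi_op w) + B (Gamma_op w) + P w = Pi_op (S w)) \<and>
       (\<forall>w. C (Pi_op w) = Q w))"
proof -
  let ?G = "\<lambda>z. A z + B (K z)" and ?\<Delta> = "\<lambda>w. B (L w) + P w"
  have Delta: "bounded_clinear ?\<Delta>"
    by (intro bounded_clinear_add bounded_clinear_compose[OF assms(2)] assms)
  have Badd: "B (x + y) = B x + B y" and Bdiff: "B (x - y) = B x - B y" for x y
    using assms(2) by (simp_all add: linear_add linear_diff bounded_linear.linear bounded_clinearD)
  have setting: "\<exists>M. plant_exosystem T DA ?G M TS DS S ?\<Delta>"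
    if T: "generates_semigroup DA ?G T" "bounded_semigroup T" for T
  proof -
    obtain M where "bounded_C0_semigroup T DA ?G M"
      using bounded_semigroup_locale[OF T] by blast
    then have "plant_exosystem T DA ?G M TS DS S ?\<Delta>"
      using assms Delta
      by (simp add: plant_exosystem_def isometric_group_def plant_exosystem_axioms_def)
    then show ?thesis
      by blast
  qed
  obtain M where "plant_exosystem TABK DA ?G M TS DS S ?\<Delta>"
    using setting assms by blast
  then interpret pe: plant_exosystem TABK DA ?G M TS DS S ?\<Delta> .
  show ?thesis
  proof
    assume "solves_SFRP DA A B C DS TS P Q K L \<and> conform TABK DS TS ?\<Delta>"
    then obtain T where T: "generates_semigroup DA ?G T" "bounded_semigroup T"
      "\<And>z0 w0. (tracking_error T TS ?\<Delta> C Q z0 w0 \<longlongrightarrow> 0) at_top" and conf: "conform TABK DS TS ?\<Delta>"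
      by (auto simp: solves_SFRP_def)
    obtain \<Psi> where Pi: "pe.sylvester \<Psi>"
      by (rule pe.conform_imp_sylvester[OF conf])
    obtain M' where "plant_exosystem T DA ?G M' TS DS S ?\<Delta>"
      using setting[OF T(1,2)] by blast
    then interpret pe': plant_exosystem T DA ?G M' TS DS S ?\<Delta> .
    \<comment> \<open>The Sylvester equation mentions the generator only, so it does not distinguish \<open>T\<close> from the
      given closed loop semigroup.\<close>
    have "pe'.sylvester \<Psi>"
      using Pi by (simp add: pe.sylvester_def pe'.sylvester_def)
    then have out: "C (\<Psi> w) = Q w" for w
      using assms T(3) by (intro pe'.regulation_imp_output_equation)
    let ?\<Gamma> = "\<lambda>w. L w + K (\<Psi> w)"
    have "bounded_clinear \<Psi>" and eq: "\<And>w. w \<in> DS \<Longrightarrow> \<Psi> w \<in> DA \<and> ?G (\<Psi> w) + ?\<Delta> w = \<Psi> (S w)"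
      using Pi by (auto simp: pe.sylvester_def)
    moreover have "bounded_clinear ?\<Gamma>"
      by (intro bounded_clinear_add bounded_clinear_compose[OF assms(8)] assms \<open>bounded_clinear \<Psi>\<close>)
    moreover have "A (\<Psi> w) + B (?\<Gamma> w) + P w = \<Psi> (S w)" if "w \<in> DS" for w
      using eq[OF that] by (simp add: Badd algebra_simps)
    ultimately show "\<exists>Pi_op Gamma_op. bounded_clinear Pi_op \<and> bounded_clinear Gamma_op \<and> Pi_op ` DS \<subseteq> DA \<and>
       (\<forall>w. L w = Gamma_op w - K (Pi_op w)) \<and>
       (\<forall>w\<in>DS. A (Pi_op w) + B (Gamma_op w) + P w = Pi_op (S w)) \<and> (\<forall>w. C (Pi_op w) = Q w)"
      using out by (intro exI[of _ \<Psi>] exI[of _ ?\<Gamma>]) auto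
  next
    assume "\<exists>Pi_op Gamma_op. bounded_clinear Pi_op \<and> bounded_clinear Gamma_op \<and> Pi_op ` DS \<subseteq> DA \<and>
       (\<forall>w. L w = Gamma_op w - K (Pi_op w)) \<and>
       (\<forall>w\<in>DS. A (Pi_op w) + B (Gamma_op w) + P w = Pi_op (S w)) \<and> (\<forall>w. C (Pi_op w) = Q w)"
    then obtain \<Psi> \<Gamma> where Pi: "bounded_clinear \<Psi>" "\<Psi> ` DS \<subseteq> DA" and L: "\<And>w. L w = \<Gamma> w - K (\<Psi> w)"
      and reg: "\<And>w. w \<in> DS \<Longrightarrow> A (\<Psi> w) + B (\<Gamma> w) + P w = \<Psi> (S w)" and out: "\<And>w. C (\<Psi> w) = Q w"
      by blast
    have "?G (\<Psi> w) + ?\<Delta> w = A (\<Psi> w) + B (\<Gamma> w) + P w" for w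
      by (simp add: L Bdiff)
    then have "?G (\<Psi> w) + ?\<Delta> w = \<Psi> (S w)" if "w \<in> DS" for w
      using reg[OF that] by (simp only:)
    then have syl: "pe.sylvester \<Psi>"
      unfolding pe.sylvester_def using Pi by blast
    obtain \<alpha> where dec: "decay_exponent DA ?G TABK \<alpha>"
      using pe.plant.polynomially_stable_imp_decay_exponent assms by blast
    have "solves_SFRP DA A B C DS TS P Q K L"
      unfolding solves_SFRP_def
      using assms pe.output_equation_imp_regulation[OF syl assms(3) out] dec by blast
    then show "solves_SFRP DA A B C DS TS P Q K L \<and> conform TABK DS TS ?\<Delta>"
      using pe.sylvester_imp_conform[OF syl dec] by simp
  qed
qed

end
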